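(* Let $C$ be the curve in $\mathbb{R}^2$ that contains the graph of $y=\tfrac34x^2-1$, $-\tfrac23\le x\le\tfrac23$, and that is invariant under rotation by $\pi/2$ about the origin (i.e. $C$ is the union of this parabolic arc and its images under rotations by $\pi/2,\pi,3\pi/2$). Then the scaled Jarník polygons $\tilde P_Q$ converge to $C$ as $Q\to\infty$: for every $\varepsilon>0$ there is $Q_0(\varepsilon)$ such that for all integers $Q>Q_0(\varepsilon)$, every point of $\tilde P_Q$ lies at distance less than $\varepsilon$ from $C$.
   Context: For a positive integer $Q$, let $V_Q=\{(q,a)\in\mathbb{Z}^2:\gcd(q,a)=1,\ \max\{|q|,|a|\}\le Q\}$ (so e.g. $(1,0),(0,1)\in V_Q$). The Jarník polygon $P_Q$ is the convex polygon, unique up to translation, whose edges (as vectors, traversed counterclockwise) are exactly the vectors of $V_Q$, each used once. $P_Q$ has the eight-fold dihedral symmetry of the square $[-1,1]^2$ about its center. The scaled polygon $\tilde P_Q$ is obtained by translating $P_Q$ so that its center of symmetry is the origin and then scaling by a positive factor so that the edge corresponding to the vector $(1,0)$ has midpoint $(0,-1)$; thus $\tilde P_Q$ passes through $(\pm1,0)$ and $(0,\pm1)$. Polygons are regarded as closed curves (their boundaries). *)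

theory Defs
  imports "HOL-Analysis.Analysis"
begin

definition jarnik_vectors :: "nat \<Rightarrow> (int \<times> int) set" where
  "jarnik_vectors Q = {(q, a). coprime q a \<and> max \<bar>q\<bar> \<bar>a\<bar> \<le> int Q}"

definition real_vec :: "int \<times> int \<Rightarrow> real \<times> real" where
  "real_vec v = (real_of_int (fst v), real_of_int (snd v))"

definition cross2 :: "real \<times> real \<Rightarrow> real \<times> real \<Rightarrow> real" where
  "cross2 u v = fst u * snd v - snd u * fst v"

(* A polygon is given by the cyclic list of its vertices. *)

definition next_vertex :: "(real \<times> real) list \<Rightarrow> nat \<Rightarrow> real \<times> real" where
  "next_vertex vs i = vs ! (Suc i mod length vs)"

definition edge_vector :: "(real \<times> real) list \<Rightarrow> nat \<Rightarrow> real \<times> real" where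
  "edge_vector vs i = next_vertex vs i - vs ! i"

definition polygon_curve :: "(real \<times> real) list \<Rightarrow> (real \<times> real) set" where
  "polygon_curve vs = (\<Union>i<length vs. closed_segment (vs ! i) (next_vertex vs i))"

(* Every vertex other than the two endpoints of an edge lies strictly to the left of the
   directed line through that edge: the polygon is convex, the list runs through its vertices
   counterclockwise and exactly once, and no three vertices are collinear. *)

definition convex_polygon_ccw :: "(real \<times> real) list \<Rightarrow> bool" where
  "convex_polygon_ccw vs \<longleftrightarrow> 3 \<le> length vs \<and>
     (\<forall>i<length vs. \<forall>j<length vs. j \<noteq> i \<and> j \<noteq> Suc i mod length vs \<longrightarrow>
        0 < cross2 (edge_vector vs i) (vs ! j - vs ! i))"

definition jarnik_polygon :: "nat \<Rightarrow> (real \<times> real) list \<Rightarrow> bool" where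
  "jarnik_polygon Q vs \<longleftrightarrow> convex_polygon_ccw vs \<and>
     bij_betw (edge_vector vs) {..<length vs} (real_vec ` jarnik_vectors Q)"

definition symmetry_center :: "(real \<times> real) set \<Rightarrow> real \<times> real \<Rightarrow> bool" where
  "symmetry_center S c \<longleftrightarrow> (\<lambda>x. 2 *\<^sub>R c - x) ` S = S"

(* P_Q is determined only up to translation, hence a relation; the scaled polygon does not
   depend on the translate chosen. That it exists is scaled_jarnik_polygon_exists below. *)

definition scaled_jarnik_polygon :: "nat \<Rightarrow> (real \<times> real) set \<Rightarrow> bool" where
  "scaled_jarnik_polygon Q S \<longleftrightarrow>
     (\<exists>vs c r. jarnik_polygon Q vs \<and> symmetry_center (polygon_curve vs) c \<and> 0 < r \<and>
        S = (\<lambda>x. r *\<^sub>R (x - c)) ` polygon_curve vs \<and>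
        (\<exists>i<length vs. edge_vector vs i = (1, 0) \<and>
           r *\<^sub>R (midpoint (vs ! i) (next_vertex vs i) - c) = (0, -1)))"

definition rot90 :: "real \<times> real \<Rightarrow> real \<times> real" where
  "rot90 p = (- snd p, fst p)"

definition parabolic_arc :: "(real \<times> real) set" where
  "parabolic_arc = {(x, 3/4 * x^2 - 1) | x. - 2/3 \<le> x \<and> x \<le> 2/3}"

definition limit_curve :: "(real \<times> real) set" where
  "limit_curve = (\<Union>k<4. (rot90 ^^ k) ` parabolic_arc)"

(* Existence: half of the edge vectors, sorted by angle, followed by their negatives. *)

lemma cross2_simps:
  "cross2 (- u) v = - cross2 u v" "cross2 u (- v) = - cross2 u v"
  "cross2 u (v + w) = cross2 u v + cross2 u w" "cross2 u (v - w) = cross2 u v - cross2 u w"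
  "cross2 u u = 0" "cross2 0 v = 0" "cross2 v 0 = 0" "cross2 v u = - cross2 u v"
  by (auto simp: cross2_def algebra_simps)

lemma symmetric_polygon_exists:
  fixes h :: "nat \<Rightarrow> real \<times> real"
  assumes m: "2 \<le> m" and h0: "h 0 = (1, 0)"
    and sorted: "\<And>i j. i < j \<Longrightarrow> j < m \<Longrightarrow> 0 < cross2 (h i) (h j)"
    and fst0: "(\<Sum>l=1..<m. fst (h l)) = 0"
  shows "\<exists>vs r. convex_polygon_ccw vs \<and>
     bij_betw (edge_vector vs) {..<length vs} (h ` {..<m} \<union> uminus ` h ` {..<m}) \<and>
     symmetry_center (polygon_curve vs) 0 \<and> 0 < r \<and> 0 < length vs \<and>
     edge_vector vs 0 = (1, 0) \<and> r *\<^sub>R midpoint (vs ! 0) (next_vertex vs 0) = (0, -1)"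
proof -
  define e where "e k = (-1::real) ^ (k div m) *\<^sub>R h (k mod m)" for k
  define p where "p k = (\<Sum>l<k. e l) - (1/2) *\<^sub>R (\<Sum>l<m. h l)" for k
  define vs where "vs = map p [0..<2*m]"
  have m0: "0 < m" using m by simp
  have e_small: "e k = h k" if "k < m" for k using that by (simp add: e_def)
  have e_shift: "e (k + m) = - e k" for k
    using m0 by (simp add: e_def)
  have p_Suc: "p (Suc k) = p k + e k" for k by (simp add: p_def)
  have p0: "p 0 = - ((1/2) *\<^sub>R (\<Sum>l<m. h l))" by (simp add: p_def)
  have "p m = (1/2) *\<^sub>R (\<Sum>l<m. h l)"
  proof -
    have "(\<Sum>l<m. e l) = (\<Sum>l<m. h l)" by (rule sum.cong) (auto simp: e_small)
    then have "p m = (\<Sum>l<m. h l) - (1/2) *\<^sub>R (\<Sum>l<m. h l)" by (simp only: p_def)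
    also have "\<dots> = (1 - 1/2) *\<^sub>R (\<Sum>l<m. h l)" by (simp only: scaleR_left_diff_distrib scaleR_one)
    finally show ?thesis by simp
  qed
  then have p_shift: "p (k + m) = - p k" for k
    by (induction k) (simp_all add: p_Suc p0 e_shift)
  have p_per: "p (k + 2*m) = p k" and e_per: "e (k + 2*m) = e k" for k
    using p_shift[of "k+m"] p_shift[of k] e_shift[of "k+m"] e_shift[of k]
    by (simp_all add: mult_2 add.assoc)
  have p_mod: "p (k mod (2*m)) = p k" for k
  proof -
    have "p (b + a * (2*m)) = p b" for a b
    proof (induction a)
      case (Suc a)
      have "p (b + Suc a * (2*m)) = p ((b + a * (2*m)) + 2*m)" by (simp add: algebra_simps)
      then show ?case using Suc p_per by simp
    qed simp
    from this[of "k mod (2*m)" "k div (2*m)"] show ?thesis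
      by (simp only: mod_div_mult_eq)
  qed
  have crossp: "0 < cross2 (e i) (e k)" if "i < k" "k < i + m" for i k
    using that
  proof (induction i arbitrary: k rule: less_induct)
    case (less i)
    show ?case
    proof (cases "i < m")
      case True
      show ?thesis
      proof (cases "k < m")
        case True
        with less \<open>i < m\<close> show ?thesis by (simp add: e_small sorted)
      next
        case False
        then have "e k = - h (k - m)"
          using e_shift[of "k - m"] less.prems \<open>i < m\<close> by (simp add: e_small)
        moreover have "0 < cross2 (h (k - m)) (h i)"
          using sorted[of "k - m" i] less.prems \<open>i < m\<close> False by simp
        ultimately show ?thesis
          using \<open>i < m\<close> by (simp add: e_small cross2_def mult.commute)
      qed
    next
      case False
      have "0 < cross2 (e (i - m)) (e (k - m))"
        using less.IH[of "i - m" "k - m"] less.prems False m0 by auto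
      then show ?thesis
        using e_shift[of "i - m"] e_shift[of "k - m"] False less.prems by (simp add: cross2_simps(1,2))
    qed
  qed
  have crossn: "cross2 (e i) (e k) < 0" if "i + m < k" "k < i + 2*m" for i k
    using crossp[of i "k - m"] e_shift[of "k - m"] that by (simp add: cross2_simps(2))
  have left1: "0 \<le> cross2 (e i) (p (i + 1 + d) - p i) \<and> (0 < d \<longrightarrow> 0 < cross2 (e i) (p (i + 1 + d) - p i))"
    if "d < m" for i d
    using that
  proof (induction d)
    case 0 then show ?case by (simp add: p_Suc cross2_simps(5))
  next
    case (Suc d)
    have "p (i + 1 + Suc d) - p i = (p (i + 1 + d) - p i) + e (i + 1 + d)"
      by (simp add: p_Suc)
    then have "cross2 (e i) (p (i + 1 + Suc d) - p i)
        = cross2 (e i) (p (i + 1 + d) - p i) + cross2 (e i) (e (i + 1 + d))"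
      by (simp only: cross2_simps(3))
    with Suc crossp[of i "i + 1 + d"] show ?case by auto
  qed
  have left2: "0 \<le> cross2 (e i) (p (i + 2*m - d) - p i) \<and> (0 < d \<longrightarrow> 0 < cross2 (e i) (p (i + 2*m - d) - p i))"
    if "d < m" for i d
    using that
  proof (induction d)
    case 0 then show ?case by (simp add: p_per cross2_simps(7))
  next
    case (Suc d)
    have *: "Suc (i + 2*m - Suc d) = i + 2*m - d" using Suc.prems by simp
    have "p (i + 2*m - Suc d) - p i = (p (i + 2*m - d) - p i) - e (i + 2*m - Suc d)"
      unfolding *[symmetric] by (simp add: p_Suc)
    then have "cross2 (e i) (p (i + 2*m - Suc d) - p i)
        = cross2 (e i) (p (i + 2*m - d) - p i) - cross2 (e i) (e (i + 2*m - Suc d))"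
      by (simp only: cross2_simps(4))
    moreover have "cross2 (e i) (e (i + 2*m - Suc d)) < 0"
      by (rule crossn) (use Suc.prems in auto)
    ultimately show ?case using Suc by auto
  qed
  have left: "0 < cross2 (e i) (p j - p i)" if "i + 1 < j" "j < i + 2*m" for i j
  proof (cases "j \<le> i + m")
    case True
    then show ?thesis using left1[of "j - i - 1" i] that by auto
  next
    case False
    have "i + 2*m - (i + 2*m - j) = j" using that by simp
    then show ?thesis using left2[of "i + 2*m - j" i] that False by auto
  qed
  have len: "length vs = 2*m" by (simp add: vs_def)
  have nth: "vs ! i = p i" if "i < 2*m" for i using that by (simp add: vs_def)
  have nxt: "next_vertex vs i = p (Suc i)" for i
    using m0 p_mod[of "Suc i"] by (simp add: next_vertex_def len nth)
  have edge: "edge_vector vs i = e i" if "i < 2*m" for i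
    using that by (simp add: edge_vector_def nxt nth p_Suc)
  have conv: "convex_polygon_ccw vs"
    unfolding convex_polygon_ccw_def len
  proof (intro conjI allI impI)
    show "3 \<le> 2*m" using m by simp
    fix i j assume i: "i < 2*m" and j: "j < 2*m" and ne: "j \<noteq> i \<and> j \<noteq> Suc i mod (2*m)"
    have "0 < cross2 (e i) (p j - p i)"
    proof (cases "i < j")
      case True
      then show ?thesis using left[of i j] j ne by (cases "j = Suc i") auto
    next
      case False
      have "j + 2*m \<noteq> Suc i"
      proof
        assume "j + 2*m = Suc i"
        then have "j = 0" "Suc i = 2*m" using i by auto
        then show False using ne by simp
      qed
      then show ?thesis using left[of i "j + 2*m"] i j ne False by (simp add: p_per)
    qed
    then show "0 < cross2 (edge_vector vs i) (vs ! j - vs ! i)" using i j by (simp add: edge nth)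
  qed
  have ne: "e i \<noteq> e k" if "i < k" "k < 2*m" for i k
  proof
    assume eq: "e i = e k"
    have 0: "cross2 (e i) (e k) = 0" by (simp add: eq cross2_simps(5))
    consider "k < i + m" | "k = i + m" | "i + m < k" by linarith
    then show False
    proof cases
      case 1 then show ?thesis using 0 crossp[of i k] that by simp
    next
      case 2
      then have "fst (e i) = - fst (e i)" "snd (e i) = - snd (e i)"
        using eq e_shift[of i] by (metis fst_uminus, metis snd_uminus)
      then have "e i = 0" by (simp add: prod_eq_iff)
      then show ?thesis using crossp[of i "Suc i"] m by (simp add: cross2_simps(6))
    next
      case 3 then show ?thesis using 0 crossn[of i k] that by simp
    qed
  qed
  have "inj_on e {..<2*m}"
    by (rule linorder_inj_onI) (use ne in auto)
  moreover have "e ` {..<2*m} = h ` {..<m} \<union> uminus ` h ` {..<m}"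
  proof -
    have "{..<2*m} = {..<m} \<union> (\<lambda>k. k + m) ` {..<m}"
    proof (intro equalityI subsetI)
      fix k assume "k \<in> {..<2*m}"
      then show "k \<in> {..<m} \<union> (\<lambda>k. k + m) ` {..<m}"
        by (cases "k < m") (auto intro!: image_eqI[of _ _ "k - m"])
    qed auto
    then have "e ` {..<2*m} = e ` {..<m} \<union> (\<lambda>k. e (k + m)) ` {..<m}"
      by (simp add: image_Un image_image)
    also have "\<dots> = h ` {..<m} \<union> uminus ` h ` {..<m}"
      by (auto simp: e_shift e_small image_image)
    finally show ?thesis .
  qed
  ultimately have "bij_betw e {..<2*m} (h ` {..<m} \<union> uminus ` h ` {..<m})"
    by (simp add: bij_betw_def)
  then have bij: "bij_betw (edge_vector vs) {..<length vs} (h ` {..<m} \<union> uminus ` h ` {..<m})"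
    using bij_betw_cong[of "{..<2*m}" "edge_vector vs" e] edge by (simp add: len)
  have curve: "polygon_curve vs = (\<Union>i. closed_segment (p i) (p (Suc i)))"
  proof (intro equalityI subsetI)
    fix x assume "x \<in> (\<Union>i. closed_segment (p i) (p (Suc i)))"
    then obtain i where x: "x \<in> closed_segment (p i) (p (Suc i))" by blast
    have "p (Suc (i mod (2*m))) = p (Suc i)"
      by (metis p_mod mod_Suc_eq)
    then have "x \<in> closed_segment (p (i mod (2*m))) (p (Suc (i mod (2*m))))"
      using x by (simp add: p_mod)
    moreover have "i mod (2*m) < 2*m" using m0 by simp
    ultimately show "x \<in> polygon_curve vs"
      unfolding polygon_curve_def len nxt using nth by auto
  qed (auto simp: polygon_curve_def len nxt nth)
  have neg: "- x \<in> polygon_curve vs" if "x \<in> polygon_curve vs" for x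
  proof -
    from that obtain i where x: "x \<in> closed_segment (p i) (p (Suc i))" unfolding curve by blast
    then have "- x \<in> closed_segment (- p i) (- p (Suc i))"
      by (force simp: closed_segment_def algebra_simps)
    then have "- x \<in> closed_segment (p (i + m)) (p (Suc (i + m)))"
      using p_shift[of i] p_shift[of "Suc i"] by simp
    then show ?thesis unfolding curve by blast
  qed
  have sym: "symmetry_center (polygon_curve vs) 0"
    unfolding symmetry_center_def using neg by (force intro!: image_eqI[of _ _ "- _"])
  define s where "s = (\<Sum>l=1..<m. snd (h l))"
  have "0 < snd (h l)" if "l \<in> {1..<m}" for l
    using sorted[of 0 l] that h0 by (simp add: cross2_def)
  then have s: "0 < s" unfolding s_def using m by (intro sum_pos) auto
  have sumh: "(\<Sum>l<m. h l) = (1, s)"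
  proof -
    have "(\<Sum>l<m. h l) = h 0 + (\<Sum>l=1..<m. h l)"
      using m0 by (simp add: lessThan_atLeast0 sum.atLeast_Suc_lessThan)
    then show ?thesis using fst0 by (simp add: prod_eq_iff fst_sum snd_sum h0 s_def)
  qed
  have "(2/s) *\<^sub>R midpoint (vs ! 0) (next_vertex vs 0) = (0, -1)"
    using m0 s by (simp add: nth nxt p_Suc e_small h0 p0 sumh midpoint_def)
  moreover have "edge_vector vs 0 = (1, 0)" using m0 by (simp add: edge e_small h0)
  ultimately show ?thesis
    using conv bij sym s m0 len by (intro exI[of _ vs] exI[of _ "2/s"]) simp
qed

lemma finite_jarnik_vectors: "finite (jarnik_vectors Q)"
proof (rule finite_subset)
  show "jarnik_vectors Q \<subseteq> {- int Q..int Q} \<times> {- int Q..int Q}"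
    by (auto simp: jarnik_vectors_def)
qed simp

theorem scaled_jarnik_polygon_exists:
  assumes Q: "1 \<le> Q"
  shows "\<exists>S. scaled_jarnik_polygon Q S"
proof -
  define U where "U = {v \<in> jarnik_vectors Q. 0 < snd v}"
  define key where "key v = - (real_of_int (fst v) / real_of_int (snd v))" for v :: "int \<times> int"
  define ks where "ks = sorted_list_of_set (key ` U)"
  define g where "g = inv_into U key"
  define m where "m = Suc (length ks)"
  define h where "h k = (case k of 0 \<Rightarrow> (1, 0) | Suc l \<Rightarrow> real_vec (g (ks ! l)))" for k
  have finU: "finite U" by (simp add: U_def finite_jarnik_vectors)
  have setks: "set ks = key ` U" using finU by (simp add: ks_def)
  have inj: "inj_on key U"
  proof (rule inj_onI)
    fix u v assume u: "u \<in> U" and v: "v \<in> U" and eq: "key u = key v"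
    obtain a b c d where uv: "u = (a, b)" "v = (c, d)" by (metis surj_pair)
    have pos: "0 < b" "0 < d" and cop: "coprime a b" "coprime c d"
      using u v by (auto simp: uv U_def jarnik_vectors_def)
    have "real_of_int (a * d) = real_of_int (c * b)"
      using eq pos by (simp add: key_def uv field_simps)
    then have *: "a * d = c * b" by linarith
    then have "\<bar>a\<bar> * \<bar>d\<bar> = \<bar>c\<bar> * \<bar>b\<bar>" by (metis abs_mult)
    then have "\<bar>b\<bar> = \<bar>d\<bar>"
      using cop coprime_crossproduct_int[of a b c d] by simp
    then show "u = v" using pos * by (auto simp: uv)
  qed
  have gU: "g (ks ! l) \<in> U" and key_g: "key (g (ks ! l)) = ks ! l" if "l < length ks" for l
    using nth_mem[OF that] unfolding setks g_def by (rule inv_into_into, rule f_inv_into_f)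
  have gimg: "(\<lambda>l. g (ks ! l)) ` {..<length ks} = U"
  proof -
    have "(\<lambda>l. g (ks ! l)) ` {..<length ks} = g ` set ks"
      by (auto simp: set_conv_nth)
    also have "\<dots> = U" using inj by (simp add: setks g_def inv_into_image_cancel)
    finally show ?thesis .
  qed
  have ks_less: "ks ! i < ks ! j" if "i < j" "j < length ks" for i j
    using that by (simp add: ks_def sorted_wrt_nth_less)
  have ginj: "inj_on (\<lambda>l. g (ks ! l)) {..<length ks}"
    by (rule linorder_inj_onI) (metis key_g ks_less lessThan_iff order.strict_trans less_irrefl, auto)
  have "(0, 1) \<in> U" using Q by (simp add: U_def jarnik_vectors_def)
  then have "ks \<noteq> []" using setks by auto
  then have m: "2 \<le> m" by (cases ks) (auto simp: m_def)
  have sorted: "0 < cross2 (h i) (h j)" if ij: "i < j" "j < m" for i j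
  proof -
    obtain b where b: "j = Suc b" "b < length ks" using ij by (cases j) (auto simp: m_def)
    have sb: "0 < snd (g (ks ! b))" using gU[OF b(2)] by (simp add: U_def)
    show ?thesis
    proof (cases i)
      case 0
      then show ?thesis using sb by (simp add: h_def b cross2_def real_vec_def)
    next
      case (Suc a)
      then have a: "a < b" using ij b by simp
      then have "0 < snd (g (ks ! a))" using gU[of a] b by (simp add: U_def)
      moreover have "key (g (ks ! a)) < key (g (ks ! b))"
        using ks_less[of a b] key_g[of a] key_g[of b] a b by simp
      ultimately show ?thesis
        using sb by (simp add: h_def b Suc cross2_def real_vec_def key_def field_simps)
    qed
  qed
  have "(\<Sum>l=1..<m. fst (h l)) = (\<Sum>l<length ks. fst (h (Suc l)))"
    unfolding m_def lessThan_atLeast0 One_nat_def by (rule sum.shift_bounds_Suc_ivl)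
  also have "\<dots> = (\<Sum>l<length ks. real_of_int (fst (g (ks ! l))))"
    by (simp add: h_def real_vec_def)
  also have "\<dots> = (\<Sum>v\<in>U. real_of_int (fst v))"
    using sum.reindex[OF ginj, of "\<lambda>v. real_of_int (fst v)"] by (simp add: gimg)
  also have "\<dots> = 0"
  proof -
    have "(\<Sum>v\<in>U. real_of_int (fst v)) = (\<Sum>v\<in>U. - real_of_int (fst v))"
      by (rule sum.reindex_bij_witness[of _ "\<lambda>v. (- fst v, snd v)" "\<lambda>v. (- fst v, snd v)"])
         (auto simp: U_def jarnik_vectors_def)
    then show ?thesis by (simp add: sum_negf)
  qed
  finally have fst0: "(\<Sum>l=1..<m. fst (h l)) = 0" .
  have "h ` {..<m} = insert (1, 0) (real_vec ` U)"
  proof -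
    have "h ` {..<m} = insert (h 0) ((\<lambda>l. h (Suc l)) ` {..<length ks})"
      by (simp add: m_def lessThan_Suc_eq_insert_0 image_image)
    also have "(\<lambda>l. h (Suc l)) ` {..<length ks} = real_vec ` U"
      by (simp add: h_def gimg[symmetric] image_image)
    finally show ?thesis by (simp add: h_def)
  qed
  moreover have "jarnik_vectors Q = insert (1, 0) U \<union> uminus ` insert (1, 0) U"
  proof (intro equalityI subsetI)
    fix v assume v: "v \<in> jarnik_vectors Q"
    obtain a b where ab: "v = (a, b)" by fastforce
    consider "0 < b" | "b < 0" | "b = 0" by linarith
    then show "v \<in> insert (1, 0) U \<union> uminus ` insert (1, 0) U"
    proof cases
      case 1 then show ?thesis using v by (simp add: ab U_def)
    next
      case 2
      then have "- v \<in> U" using v by (auto simp: ab U_def jarnik_vectors_def)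
      then have "v \<in> uminus ` U" by (metis image_eqI minus_minus)
      then show ?thesis by auto
    next
      case 3
      then have "a = 1 \<or> a = -1" using v by (auto simp: ab jarnik_vectors_def)
      then show ?thesis using 3 by (auto simp: ab)
    qed
  next
    fix v assume "v \<in> insert (1, 0) U \<union> uminus ` insert (1, 0) U"
    then show "v \<in> jarnik_vectors Q" using Q by (auto simp: U_def jarnik_vectors_def)
  qed
  ultimately have V: "real_vec ` jarnik_vectors Q = h ` {..<m} \<union> uminus ` h ` {..<m}"
    by (simp add: image_Un image_image real_vec_def uminus_prod_def)
  have "h 0 = (1, 0)" by (simp add: h_def)
  from symmetric_polygon_exists[OF m this sorted fst0]
  show ?thesis
    unfolding scaled_jarnik_polygon_def jarnik_polygon_def V by (metis diff_zero)
qed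

end

(* The edges of a convex polygon occur in angular order, so the edges strictly to the left of an
   edge e are exactly those between e and the opposite edge -e, and central symmetry puts the midpoint
   of e at -S(e)/2 relative to the centre, where S(e) is the sum of the w in V_Q with cross2 e w > 0.
   The scaled midpoint is therefore -S(e)/s with s = |S(1,0)|, and it remains to compare S(e) with s.
   For the sums over all lattice points of the half square this is elementary, with error O(Q^2). These
   full sums are \<Sum>d. d * S_{Q div d}(e), and since \<Sum>d\<ge>2. d powr (-15/8) < 1, a strong induction
   transfers the comparison to S(e) with error O(Q powr (23/8)) = o(Q^3), while s is of order Q^3. For
   e = (q, a) with |a| \<le> q and t = a/q, the limit of -S(e)/s is (2t/3, t^2/3 - 1), on the parabola. *)

theory Submission
  imports Defs "HOL-Real_Asymp.Real_Asymp"
begin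

section \<open>Sums over primitive vectors in a half-plane\<close>

text \<open>Comparison with the integral of \<open>x powr (- 1 - u)\<close>, telescoped. Each step
  is the inequality \<open>1 + u * x \<le> (1 - x) powr - u\<close> at
  \<open>x = 1 / (N + 1)\<close>, which follows from \<open>1 + y \<le> exp y\<close> and
  \<open>ln (1 - x) \<le> - x\<close>.\<close>

lemma sum_powr_tail_le:
  fixes u :: real
  assumes u: "0 < u" and M: "1 \<le> M" "M \<le> N"
  shows "(\<Sum>d=Suc M..N. real d powr (- 1 - u)) \<le> (real M powr - u - real N powr - u) / u"
  using M(2)
proof (induction N rule: dec_induct)
  case base
  then show ?case by simp
next
  case (step N)
  have N: "1 \<le> N" using step M by simp
  define x where "x = 1 / real (Suc N)"
  have x: "0 < x" "x < 1" using N by (auto simp: x_def)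
  have "1 + u * x \<le> exp (u * x)" by (rule exp_ge_add_one_self)
  also have "\<dots> \<le> exp (- u * ln (1 - x))"
  proof -
    have "ln (1 - x) \<le> - x" using ln_le_minus_one[of "1 - x"] x by simp
    then have "u * ln (1 - x) \<le> u * (- x)" using u by (intro mult_left_mono) auto
    then show ?thesis by simp
  qed
  also have "\<dots> = (1 - x) powr - u" using x by (simp add: powr_def)
  finally have "1 + u * x \<le> (1 - x) powr - u" .
  then have "real (Suc N) powr - u * (1 + u * x) \<le> real (Suc N) powr - u * (1 - x) powr - u"
    by (intro mult_left_mono) auto
  also have "\<dots> = (real (Suc N) * (1 - x)) powr - u" using x by (simp add: powr_mult)
  also have "real (Suc N) * (1 - x) = real N" by (simp add: x_def field_simps)
  finally have "u * (real (Suc N) powr - u * x) \<le> real N powr - u - real (Suc N) powr - u"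
    by (simp add: algebra_simps)
  moreover have "real (Suc N) powr - u * x = real (Suc N) powr (- 1 - u)"
  proof -
    have "- 1 - u = - u + (- 1)" by simp
    then have "real (Suc N) powr (- 1 - u) = real (Suc N) powr - u * real (Suc N) powr - 1"
      by (simp only: powr_add)
    then show ?thesis by (simp add: x_def powr_minus_divide)
  qed
  ultimately have "real (Suc N) powr (- 1 - u) \<le> (real N powr - u - real (Suc N) powr - u) / u"
    using u by (simp add: field_simps)
  moreover have "(\<Sum>d=Suc M..Suc N. real d powr (- 1 - u))
      = (\<Sum>d=Suc M..N. real d powr (- 1 - u)) + real (Suc N) powr (- 1 - u)"
    using step by simp
  moreover have "(real M powr - u - real N powr - u) / u + (real N powr - u - real (Suc N) powr - u) / u
      = (real M powr - u - real (Suc N) powr - u) / u"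
    by (simp add: diff_divide_distrib)
  ultimately show ?case using step.IH by linarith
qed

text \<open>The eighth power of the claim is \<open>1.8 ^ 8 \<le> 2 ^ 7\<close>. The value 1.8 is
  precise enough because the bound 11/12 on the power sum from 2 on asks for at least
  138/77.\<close>

lemma two_powr_lower: "1.8 \<le> (2::real) powr (7/8)"
proof -
  have "(1.8::real) = 1.8 powr (8 * (1/8))" by simp
  also have "\<dots> = (1.8 powr 8) powr (1/8)" by (simp only: powr_powr)
  also have "(1.8::real) powr 8 = 1.8 ^ 8" by (simp add: powr_numeral)
  also have "((1.8::real) ^ 8) powr (1/8) \<le> (2 ^ 7) powr (1/8)"
    by (intro powr_mono2) (simp_all add: power_divide field_simps)
  also have "((2::real) ^ 7) powr (1/8) = (2 powr 7) powr (1/8)" by (simp add: powr_numeral)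
  also have "\<dots> = 2 powr (7/8)" by (simp only: powr_powr) simp
  finally show ?thesis by simp
qed

text \<open>The exponent balances two demands. The sum of \<open>d powr - s\<close> over all
  \<open>d \<ge> 2\<close> must be below 1, which holds for s = 15/8 but fails for s = 3/2; and s <
  2 keeps the error exponent 1 + s = 23/8 below 3.\<close>

lemma sum_powr_from_2_le: "(\<Sum>d=2..N. real d powr (- 15/8)) \<le> 11/12"
proof (cases "N < 2")
  case False
  have e: "- 15/8 = - 1 - (7/8::real)" by simp
  \<comment> \<open>The term d = 2 is kept exactly, since the tail bound started at
    \<open>M = 1\<close> would only give 8/7.\<close>
  have "(\<Sum>d=2..N. real d powr (- 15/8))
      = 2 powr (- 15/8) + (\<Sum>d=Suc 2..N. real d powr (- 15/8))"
    using False by (subst sum.atLeast_Suc_atMost) auto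
  also have "(\<Sum>d=Suc 2..N. real d powr (- 15/8)) \<le> (real 2 powr - (7/8) - real N powr - (7/8)) / (7/8)"
    unfolding e by (rule sum_powr_tail_le) (use False in auto)
  also have "\<dots> \<le> (2 powr - (7/8)) / (7/8)" by (simp add: divide_right_mono)
  also have "2 powr (- 15/8) = (2 powr - (7/8)) * (1/2 :: real)"
  proof -
    have "(2::real) powr (- 15/8) = 2 powr (- (7/8) + (- 1))" by simp
    also have "\<dots> = (2 powr - (7/8)) * 2 powr - 1" by (simp only: powr_add)
    finally show ?thesis by (simp add: powr_minus_divide)
  qed
  finally have "(\<Sum>d=2..N. real d powr (- 15/8)) \<le> 2 powr - (7/8) * (23/14)" by simp
  also have "\<dots> \<le> 1/1.8 * (23/14)"
    by (intro mult_right_mono) (use two_powr_lower in \<open>simp_all add: powr_minus_divide field_simps\<close>)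
  finally show ?thesis by simp
qed simp

text \<open>Links the two exponents: a bound of order \<open>N powr (23/8)\<close>, used at
  \<open>N div d\<close> and weighted by d, gains the factor \<open>d powr (1 - 23/8)\<close>, which
  is summable with sum below 1.\<close>

lemma mult_div_powr_le:
  assumes "1 \<le> d"
  shows "real d * real (N div d) powr (23/8) \<le> real N powr (23/8) * real d powr (- 15/8)"
proof -
  have "real d * real (N div d) powr (23/8) \<le> real d powr 1 * (real N / real d) powr (23/8)"
    using assms by (auto intro!: mult_left_mono powr_mono2 of_nat_div_le_of_nat)
  also have "\<dots> = real N powr (23/8) * (real d powr 1 * real d powr - (23/8))"
    using assms by (simp add: powr_divide powr_minus_divide)
  also have "real d powr 1 * real d powr - (23/8) = real d powr (- 15/8)"
    unfolding powr_add[symmetric] by simp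
  finally show ?thesis .
qed

text \<open>A substitute for Moebius inversion: since \<open>\<Sum>d\<ge>2. d powr (- 15/8) < 1\<close>, the terms with \<open>d \<ge> 2\<close>
  can be absorbed in a strong induction.\<close>

lemma dilation_sum_bound:
  fixes D :: "nat \<Rightarrow> real"
  assumes bound: "\<And>N. 1 \<le> N \<Longrightarrow> \<bar>\<Sum>d=1..N. real d * D (N div d)\<bar> \<le> C * real N powr (23/8)"
    and N: "1 \<le> N"
  shows "\<bar>D N\<bar> \<le> 12 * C * real N powr (23/8)"
  using N
proof (induction N rule: less_induct)
  case (less N)
  have "\<bar>\<Sum>d=2..N. real d * D (N div d)\<bar> \<le> (\<Sum>d=2..N. \<bar>real d * D (N div d)\<bar>)"
    by (rule sum_abs)
  also have "\<dots> \<le> (\<Sum>d=2..N. 12 * C * real N powr (23/8) * real d powr (- 15/8))"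
  proof (rule sum_mono)
    fix d assume d: "d \<in> {2..N}"
    have "\<bar>D (N div d)\<bar> \<le> 12 * C * real (N div d) powr (23/8)"
      using d by (intro less.IH) (auto simp: Suc_le_eq div_greater_zero_iff)
    then have "\<bar>real d * D (N div d)\<bar> \<le> real d * (12 * C * real (N div d) powr (23/8))"
      by (simp add: abs_mult mult_left_mono)
    also have "\<dots> = 12 * C * (real d * real (N div d) powr (23/8))" by simp
    also have "\<dots> \<le> 12 * C * (real N powr (23/8) * real d powr (- 15/8))"
    proof (intro mult_left_mono mult_div_powr_le)
      \<comment> \<open>At \<open>N = 1\<close> the hypothesis reads
        \<open>\<bar>D 1\<bar> \<le> C\<close>, so C is nonnegative.\<close>
      show "0 \<le> 12 * C" using bound[of 1] by simp
    qed (use d in auto)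
    finally show "\<bar>real d * D (N div d)\<bar> \<le> 12 * C * real N powr (23/8) * real d powr (- 15/8)"
      by simp
  qed
  also have "\<dots> = 12 * C * real N powr (23/8) * (\<Sum>d=2..N. real d powr (- 15/8))"
    by (simp add: sum_distrib_left)
  also have "\<dots> \<le> 12 * C * real N powr (23/8) * (11/12)"
    by (intro mult_left_mono sum_powr_from_2_le) (use bound[of 1] in auto)
  finally have "\<bar>\<Sum>d=2..N. real d * D (N div d)\<bar> \<le> 11 * C * real N powr (23/8)" by simp
  moreover have "(\<Sum>d=1..N. real d * D (N div d)) = D N + (\<Sum>d=2..N. real d * D (N div d))"
    using less.prems by (subst sum.atLeast_Suc_atMost) (auto simp: numeral_2_eq_2)
  \<comment> \<open>The constant 12 reproduces itself: the terms with \<open>d \<ge> 2\<close> use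
    up 12 * 11/12 = 11 multiples of C, and the hypothesis at N adds one more.\<close>
  ultimately show ?case using bound[OF less.prems] by linarith
qed

section \<open>Lattice points of a box sorted by their gcd\<close>

text \<open>Every nonzero lattice point is d times a primitive vector for exactly one d > 0, its
  gcd, and it lies in the box of size N iff the primitive vector lies in the box of size
  \<open>N div d\<close>. Homogeneity of f produces the weight d; the origin, which has no such
  representation, is excluded by \<open>H0\<close>.\<close>

lemma sum_box_eq_sum_jarnik:
  fixes f :: "int \<times> int \<Rightarrow> real"
  assumes H: "\<And>d x y. 0 < d \<Longrightarrow> P (d * x, d * y) \<longleftrightarrow> P (x, y)" and H0: "\<not> P (0, 0)"
    and f: "\<And>d x y. f (d * x, d * y) = of_int d * f (x, y)"
  shows "(\<Sum>w | w \<in> {- int N..int N} \<times> {- int N..int N} \<and> P w. f w)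
    = (\<Sum>d=1..N. real d * (\<Sum>w | w \<in> jarnik_vectors (N div d) \<and> P w. f w))"
proof -
  have "(\<Sum>d=1..N. real d * (\<Sum>w | w \<in> jarnik_vectors (N div d) \<and> P w. f w))
    = (\<Sum>d=1..N. \<Sum>w | w \<in> jarnik_vectors (N div d) \<and> P w. real d * f w)"
    by (simp add: sum_distrib_left)
  also have "\<dots> = (\<Sum>(d, w)\<in>(SIGMA d:{1..N}. {w. w \<in> jarnik_vectors (N div d) \<and> P w}). real d * f w)"
    by (rule sum.Sigma) (auto simp: finite_jarnik_vectors)
  also have "\<dots> = (\<Sum>w | w \<in> {- int N..int N} \<times> {- int N..int N} \<and> P w. f w)"
  proof (rule sum.reindex_bij_witness[of _
        "\<lambda>(x, y). (nat (gcd x y), (x div gcd x y, y div gcd x y))"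
        "\<lambda>(d, (x, y)). (int d * x, int d * y)"], goal_cases)
    case (1 a)
    then obtain d x y where a: "a = (d, (x, y))" and d: "1 \<le> d" "d \<le> N"
      and xy: "coprime x y" by (auto simp: jarnik_vectors_def)
    then show ?case by (simp add: gcd_mult_distrib_int[symmetric])
  next
    case (2 a)
    then obtain d x y where a: "a = (d, (x, y))" and d: "1 \<le> d" "d \<le> N"
      and xy: "coprime x y" "\<bar>x\<bar> \<le> int (N div d)" "\<bar>y\<bar> \<le> int (N div d)" "P (x, y)"
      by (auto simp: jarnik_vectors_def)
    have le: "\<bar>int d * z\<bar> \<le> int N" if "\<bar>z\<bar> \<le> int (N div d)" for z
    proof -
      have "\<bar>int d * z\<bar> \<le> int d * int (N div d)" using that by (simp add: abs_mult mult_left_mono)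
      also have "\<dots> \<le> int N" by (metis of_nat_mult of_nat_le_iff times_div_less_eq_dividend)
      finally show ?thesis .
    qed
    show ?case using le[OF xy(2)] le[OF xy(3)] H[of "int d" x y] d xy(4) by (simp add: a abs_le_iff)
  next
    case (3 a)
    then show ?case by (cases a) simp
  next
    case (4 a)
    obtain x y where a: "a = (x, y)" by fastforce
    define g where "g = gcd x y"
    have xy: "\<bar>x\<bar> \<le> int N" "\<bar>y\<bar> \<le> int N" "P (x, y)" using 4 by (auto simp: a)
    then have ne: "x \<noteq> 0 \<or> y \<noteq> 0" using H0 by auto
    then have g: "0 < g" by (simp add: g_def)
    have "g \<le> int N"
    proof (cases "x = 0")
      case True
      then show ?thesis using xy by (simp add: g_def)
    next
      case False
      then have "g \<le> \<bar>x\<bar>" using gcd_le1_int[of "\<bar>x\<bar>" y] by (simp add: g_def)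
      then show ?thesis using xy by simp
    qed
    obtain x' y' where x': "x = g * x'" and y': "y = g * y'"
      unfolding g_def by (metis dvdE gcd_dvd1 gcd_dvd2)
    have div: "x div g = x'" "y div g = y'" using g by (simp_all add: x' y')
    have "coprime (x div g) (y div g)" unfolding g_def using ne by (rule div_gcd_coprime)
    then have cop: "coprime x' y'" by (simp add: div)
    have le: "\<bar>z\<bar> \<le> int (N div nat g)" if "\<bar>g * z\<bar> \<le> int N" for z
    proof -
      have "\<bar>z\<bar> * g \<le> int N" using that g by (simp add: abs_mult mult.commute)
      then have "\<bar>z\<bar> \<le> int N div g" using g zdiv_mono1[of "\<bar>z\<bar> * g" "int N" g] by simp
      then show ?thesis using g by (simp add: zdiv_int)
    qed
    have "P (x', y')" using xy(3) H[OF g, of x' y'] by (simp add: x' y')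
    moreover have "\<bar>x'\<bar> \<le> int (N div nat g)" "\<bar>y'\<bar> \<le> int (N div nat g)"
      using xy(1,2) by (auto intro: le simp: x' y')
    moreover have "1 \<le> nat g" "nat g \<le> N" using g \<open>g \<le> int N\<close> by linarith+
    ultimately show ?case
      using g cop by (simp add: a div jarnik_vectors_def flip: g_def)
  next
    case (5 a)
    then obtain d x y where a: "a = (d, (x, y))" by (metis surj_pair)
    show ?case using f[of "int d" x y] by (simp add: a)
  qed
  finally show ?thesis by simp
qed

section \<open>Lattice point sums over half of a square\<close>

lemma sum_symmetric_interval_Suc:
  "(\<Sum>x\<in>{- int (Suc N)..int (Suc N)}. g x)
    = (g (- int (Suc N)) + g (int (Suc N)) + (\<Sum>x\<in>{- int N..int N}. g x) :: real)"
proof -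
  have "{- int (Suc N)..int (Suc N)} = insert (- int (Suc N)) (insert (int (Suc N)) {- int N..int N})"
    by auto
  then show ?thesis by simp
qed

lemma sum_symmetric_interval: "(\<Sum>x\<in>{- int N..int N}. real_of_int x) = 0"
  by (induction N) (simp_all add: sum_symmetric_interval_Suc del: of_nat_Suc)

lemma sum_squares_symmetric_interval:
  "(\<Sum>x\<in>{- int N..int N}. (real_of_int x)\<^sup>2) = real N * (real N + 1) * (2 * real N + 1) / 3"
proof (induction N)
  case (Suc N)
  show ?case unfolding sum_symmetric_interval_Suc Suc
    by (simp add: power2_eq_square field_simps)
qed simp

lemma sum_int_interval:
  fixes m n :: int
  assumes "m \<le> n"
  shows "(\<Sum>y\<in>{m + 1..n}. real_of_int y) = (of_int n * (of_int n + 1) - of_int m * (of_int m + 1)) / 2"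
  using assms
proof (induction n rule: int_ge_induct)
  case (step n)
  have "{m + 1..n + 1} = insert (n + 1) {m + 1..n}" using step by auto
  then show ?case using step by (simp add: field_simps)
qed simp

text \<open>The sum of the ordinates of all lattice points with y > 0 in the square of half side N;
  the full-lattice counterpart of \<open>height\<close>.\<close>

definition lattice_sum :: "nat \<Rightarrow> real" where
  "lattice_sum N = real N * (real N + 1) * (2 * real N + 1) / 2"

text \<open>The condition \<open>0 < cross2 (q, a) w\<close> over the integers: w points strictly to
  the left of the direction (q, a).\<close>

definition half_plane :: "int \<Rightarrow> int \<Rightarrow> int \<times> int \<Rightarrow> bool" where
  "half_plane q a w \<longleftrightarrow> 0 < q * snd w - a * fst w"

text \<open>For \<open>\<bar>a\<bar> \<le> q\<close> the line through the origin with slope a/q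
  stays inside the square over all of \<open>{- N..N}\<close>. So the half square consists, over
  each abscissa x, of the y from the floor of a x / q (exclusive) up to N.\<close>

lemma half_box_sum:
  fixes f :: "int \<times> int \<Rightarrow> real"
  assumes q: "0 < q" and a: "\<bar>a\<bar> \<le> q"
  shows "(\<Sum>w | w \<in> {- int N..int N} \<times> {- int N..int N} \<and> half_plane q a w. f w)
    = (\<Sum>x\<in>{- int N..int N}. \<Sum>y\<in>{a * x div q + 1..int N}. f (x, y))"
    and "\<And>x. x \<in> {- int N..int N} \<Longrightarrow> - int N \<le> a * x div q \<and> a * x div q \<le> int N"
proof -
  show *: "- int N \<le> a * x div q \<and> a * x div q \<le> int N" if "x \<in> {- int N..int N}" for x
  proof -
    have "\<bar>a * x\<bar> \<le> q * int N" unfolding abs_mult using that a q by (intro mult_mono) auto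
    then have "- int N * q \<le> a * x" "a * x \<le> int N * q" by (auto simp: mult.commute abs_le_iff)
    then have "(- int N * q) div q \<le> a * x div q" "a * x div q \<le> int N * q div q"
      using q by (simp_all only: zdiv_mono1)
    moreover have "(- int N * q) div q = - int N" "int N * q div q = int N"
      by (rule nonzero_mult_div_cancel_right, use q in simp)+
    ultimately show ?thesis by simp
  qed
  have iff: "half_plane q a (x, y) \<longleftrightarrow> a * x div q + 1 \<le> y" for x y
  proof -
    define m where "m = a * x div q"
    have "a * x = q * m + a * x mod q" by (simp add: m_def)
    moreover have "0 \<le> a * x mod q" "a * x mod q < q" using q by auto
    ultimately have m: "q * m \<le> a * x" "a * x < q * (m + 1)" by (auto simp: algebra_simps)
    show ?thesis
    proof (cases "m + 1 \<le> y")
      case True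
      then have "q * (m + 1) \<le> q * y" using q by (intro mult_left_mono) auto
      then show ?thesis using m True by (simp add: half_plane_def flip: m_def)
    next
      case False
      then have "q * y \<le> q * m" using q by (intro mult_left_mono) auto
      then show ?thesis using m False by (simp add: half_plane_def flip: m_def)
    qed
  qed
  have "{w. w \<in> {- int N..int N} \<times> {- int N..int N} \<and> half_plane q a w}
     = (SIGMA x:{- int N..int N}. {a * x div q + 1..int N})"
    using * by (fastforce simp: iff)
  then show "(\<Sum>w | w \<in> {- int N..int N} \<times> {- int N..int N} \<and> half_plane q a w. f w)
    = (\<Sum>x\<in>{- int N..int N}. \<Sum>y\<in>{a * x div q + 1..int N}. f (x, y))"
    by (simp add: sum.Sigma)
qed

lemma abs_sum_interval_le:
  fixes g :: "int \<Rightarrow> real"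
  assumes "\<And>x. x \<in> {- int N..int N} \<Longrightarrow> \<bar>g x\<bar> \<le> real N"
  shows "\<bar>\<Sum>x\<in>{- int N..int N}. g x\<bar> \<le> 3 * (real N)\<^sup>2"
proof -
  have "\<bar>\<Sum>x\<in>{- int N..int N}. g x\<bar> \<le> (\<Sum>x\<in>{- int N..int N}. real N)"
    using assms by (intro order_trans[OF sum_abs] sum_mono)
  also have "\<dots> = (2 * real N + 1) * real N" by simp
  also have "\<dots> \<le> 3 * (real N)\<^sup>2" by (cases N) (auto simp: power2_eq_square algebra_simps)
  finally show ?thesis .
qed

text \<open>The floor of t x is written as t x minus its fractional part \<open>\<theta> x\<close>.
  The terms without \<open>\<theta>\<close> sum up exactly, and the rest contributes at most N for
  each x. The error is uniform in the direction (q, a).\<close>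

lemma
  fixes q a :: int
  assumes q: "0 < q" and a: "\<bar>a\<bar> \<le> q"
  defines "t \<equiv> real_of_int a / real_of_int q"
  shows half_box_sum_fst:
    "\<bar>(\<Sum>w | w \<in> {- int N..int N} \<times> {- int N..int N} \<and> half_plane q a w. real_of_int (fst w))
      + 2 * t / 3 * lattice_sum N\<bar> \<le> 3 * (real N)\<^sup>2" (is "\<bar>?X + _\<bar> \<le> _")
    and half_box_sum_snd:
    "\<bar>(\<Sum>w | w \<in> {- int N..int N} \<times> {- int N..int N} \<and> half_plane q a w. real_of_int (snd w))
      - (1 - t\<^sup>2 / 3) * lattice_sum N\<bar> \<le> 3 * (real N)\<^sup>2" (is "\<bar>?Y - _\<bar> \<le> _")
proof -
  let ?I = "{- int N..int N}"
  define m where "m x = a * x div q" for x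
  define \<theta> where "\<theta> x = t * real_of_int x - real_of_int (m x)" for x
  have m: "real_of_int (m x) = t * real_of_int x - \<theta> x" for x by (simp add: \<theta>_def)
  have m_le: "m x \<le> int N" if "x \<in> ?I" for x
    using half_box_sum(2)[OF q a that] by (simp add: m_def)
  have \<theta>: "0 \<le> \<theta> x" "\<theta> x \<le> 1" for x
  proof -
    have eq: "\<theta> x = real_of_int (a * x) / real_of_int q - real_of_int \<lfloor>real_of_int (a * x) / real_of_int q\<rfloor>"
      unfolding \<theta>_def m_def floor_divide_of_int_eq by (simp add: t_def)
    show "0 \<le> \<theta> x" "\<theta> x \<le> 1" unfolding eq by linarith+
  qed
  \<comment> \<open>An exact multiple of \<open>lattice_sum N\<close>; the ratio 2/3 turns the
    coefficients t and t^2/2 of the quadratic terms into 2t/3 and t^2/3.\<close>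
  have sq: "(\<Sum>x\<in>?I. (real_of_int x)\<^sup>2) = 2 / 3 * lattice_sum N"
    by (simp add: sum_squares_symmetric_interval lattice_sum_def)
  have t: "\<bar>t\<bar> \<le> 1" using q a by (simp add: t_def)
  have tx: "\<bar>t * real_of_int x\<bar> \<le> real N" if "x \<in> ?I" for x
  proof -
    have "\<bar>t\<bar> * \<bar>real_of_int x\<bar> \<le> 1 * real N"
      using t that by (intro mult_mono) auto
    then show ?thesis by (simp add: abs_mult)
  qed
  have "?X = (\<Sum>x\<in>?I. real_of_int x * (real N - real_of_int (m x)))"
    unfolding half_box_sum(1)[OF q a]
  proof (rule sum.cong[OF refl])
    fix x assume "x \<in> ?I"
    then have "real (card {m x + 1..int N}) = real N - real_of_int (m x)" using m_le[of x] by simp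
    then show "(\<Sum>y\<in>{a * x div q + 1..int N}. real_of_int (fst (x, y)))
      = real_of_int x * (real N - real_of_int (m x))"
      unfolding m_def by (simp only: fst_conv sum_constant mult.commute)
  qed
  also have "\<dots> = (\<Sum>x\<in>?I. real N * real_of_int x - t * (real_of_int x)\<^sup>2 + real_of_int x * \<theta> x)"
    by (rule sum.cong) (auto simp: m power2_eq_square algebra_simps)
  also have "\<dots> = real N * (\<Sum>x\<in>?I. real_of_int x) - t * (\<Sum>x\<in>?I. (real_of_int x)\<^sup>2)
      + (\<Sum>x\<in>?I. real_of_int x * \<theta> x)"
    by (simp add: sum.distrib sum_subtractf sum_distrib_left)
  finally have X: "?X + 2 * t / 3 * lattice_sum N = (\<Sum>x\<in>?I. real_of_int x * \<theta> x)"
    by (simp add: sum_symmetric_interval sq)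
  show "\<bar>?X + 2 * t / 3 * lattice_sum N\<bar> \<le> 3 * (real N)\<^sup>2"
    unfolding X
  proof (rule abs_sum_interval_le)
    fix x assume "x \<in> ?I"
    then have "\<bar>real_of_int x\<bar> * \<bar>\<theta> x\<bar> \<le> real N * 1"
      using \<theta>[of x] by (intro mult_mono) auto
    then show "\<bar>real_of_int x * \<theta> x\<bar> \<le> real N" by (simp add: abs_mult)
  qed
  \<comment> \<open>With m = t x - \<theta> one has m (m + 1) / 2 = t^2 x^2 / 2 +
    \<open>R x\<close>, so R collects everything except the quadratic term.\<close>
  define R where "R x = (t * real_of_int x * (1 - 2 * \<theta> x) - \<theta> x * (1 - \<theta> x)) / 2" for x
  have "?Y = (\<Sum>x\<in>?I. (real N * (real N + 1) - real_of_int (m x) * (real_of_int (m x) + 1)) / 2)"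
    unfolding half_box_sum(1)[OF q a]
    by (rule sum.cong) (use m_le sum_int_interval in \<open>auto simp flip: m_def\<close>)
  also have "\<dots> = (\<Sum>x\<in>?I. real N * (real N + 1) / 2 - t\<^sup>2 / 2 * (real_of_int x)\<^sup>2 - R x)"
    by (rule sum.cong) (auto simp: m R_def power2_eq_square field_simps)
  also have "\<dots> = (2 * real N + 1) * (real N * (real N + 1) / 2)
      - t\<^sup>2 / 2 * (\<Sum>x\<in>?I. (real_of_int x)\<^sup>2) - (\<Sum>x\<in>?I. R x)"
    by (simp add: sum_subtractf sum_distrib_left)
  also have "(2 * real N + 1) * (real N * (real N + 1) / 2) = lattice_sum N"
    by (simp add: lattice_sum_def)
  finally have Y: "?Y - (1 - t\<^sup>2 / 3) * lattice_sum N = - (\<Sum>x\<in>?I. R x)"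
    by (simp add: sq algebra_simps)
  show "\<bar>?Y - (1 - t\<^sup>2 / 3) * lattice_sum N\<bar> \<le> 3 * (real N)\<^sup>2"
    unfolding Y abs_minus_cancel
  proof (rule abs_sum_interval_le)
    fix x assume x: "x \<in> ?I"
    have "\<bar>t * real_of_int x\<bar> * \<bar>1 - 2 * \<theta> x\<bar> \<le> real N * 1"
      using \<theta>[of x] tx[OF x] by (intro mult_mono) auto
    then have 1: "\<bar>t * real_of_int x * (1 - 2 * \<theta> x)\<bar> \<le> real N" by (simp add: abs_mult)
    have 2: "0 \<le> \<theta> x * (1 - \<theta> x)" "\<theta> x * (1 - \<theta> x) \<le> 1 * 1"
      using \<theta>[of x] by (simp, intro mult_mono) auto
    \<comment> \<open>The estimate of R bounds \<theta> (1 - \<theta>) by 1 and therefore uses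
      \<open>1 \<le> N\<close>. For \<open>N = 0\<close> the only abscissa is 0, where R
      vanishes.\<close>
    have "R x = 0" if "N = 0"
    proof -
      have "x = 0" using x that by simp
      then show ?thesis by (simp add: R_def \<theta>_def m_def)
    qed
    moreover have "\<bar>R x\<bar> \<le> real N" if "1 \<le> N"
    proof -
      have "\<bar>(A - B) / 2\<bar> \<le> n" if "\<bar>A\<bar> \<le> n" "0 \<le> B" "B \<le> 1" "1 \<le> n" for A B n :: real
        using that by (simp add: abs_le_iff)
      from this[OF 1 2(1)] 2(2) that show ?thesis by (simp add: R_def)
    qed
    ultimately show "\<bar>R x\<bar> \<le> real N" by (cases "N = 0") auto
  qed
qed

section \<open>Half-plane sums over primitive vectors\<close>

definition half_sum :: "nat \<Rightarrow> int \<Rightarrow> int \<Rightarrow> real \<times> real" where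
  "half_sum Q q a = (\<Sum>w | w \<in> jarnik_vectors Q \<and> half_plane q a w. real_vec w)"

lemma
  shows sum_dilated_fst_half_sum: "(\<Sum>d=1..N. real d * fst (half_sum (N div d) q a))
    = (\<Sum>w | w \<in> {- int N..int N} \<times> {- int N..int N} \<and> half_plane q a w. real_of_int (fst w))"
  and sum_dilated_snd_half_sum: "(\<Sum>d=1..N. real d * snd (half_sum (N div d) q a))
    = (\<Sum>w | w \<in> {- int N..int N} \<times> {- int N..int N} \<and> half_plane q a w. real_of_int (snd w))"
proof -
  have H: "half_plane q a (d * x, d * y) \<longleftrightarrow> half_plane q a (x, y)" if "0 < d" for d x y
  proof -
    have "q * (d * y) - a * (d * x) = d * (q * y - a * x)" by (simp add: algebra_simps)
    then show ?thesis using that by (simp add: half_plane_def zero_less_mult_iff)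
  qed
  have H0: "\<not> half_plane q a (0, 0)" by (simp add: half_plane_def)
  show "(\<Sum>d=1..N. real d * fst (half_sum (N div d) q a))
    = (\<Sum>w | w \<in> {- int N..int N} \<times> {- int N..int N} \<and> half_plane q a w. real_of_int (fst w))"
    by (subst sum_box_eq_sum_jarnik[OF H H0]) (simp_all add: half_sum_def fst_sum real_vec_def)
  show "(\<Sum>d=1..N. real d * snd (half_sum (N div d) q a))
    = (\<Sum>w | w \<in> {- int N..int N} \<times> {- int N..int N} \<and> half_plane q a w. real_of_int (snd w))"
    by (subst sum_box_eq_sum_jarnik[OF H H0]) (simp_all add: half_sum_def snd_sum real_vec_def)
qed

text \<open>The half-plane of the direction (1, 0) is y > 0, so this is the total rise of the
  unscaled polygon from its bottom edge to its top edge. The scaling factor will turn out to be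
  \<open>2 / height Q\<close>.\<close>

definition height :: "nat \<Rightarrow> real" where
  "height Q = snd (half_sum Q 1 0)"

text \<open>Exact, because for the direction (1, 0) all the floors are 0. Hence
  \<open>lattice_sum\<close> in the half-box estimates may be traded for a dilated sum of
  \<open>height\<close>.\<close>

lemma sum_dilated_height: "(\<Sum>d=1..N. real d * height (N div d)) = lattice_sum N"
proof -
  have "(\<Sum>d=1..N. real d * height (N div d)) = (\<Sum>x\<in>{- int N..int N}. \<Sum>y\<in>{1..int N}. real_of_int y)"
    unfolding height_def sum_dilated_snd_half_sum half_box_sum(1)[of 1 0, simplified] by simp
  also have "\<dots> = lattice_sum N"
    using sum_int_interval[of 0 "int N"] by (simp add: lattice_sum_def)
  finally show ?thesis .
qed

lemma square_le_powr: "1 \<le> N \<Longrightarrow> (real N)\<^sup>2 \<le> real N powr (23/8)"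
  using powr_mono[of 2 "23/8" "real N"] by (simp add: powr_numeral)

text \<open>\<open>dilation_sum_bound\<close> is applied to the difference between a coordinate of
  \<open>half_sum\<close> and its expected multiple of \<open>height\<close>: the dilated sum of
  this difference is the half-box error, at most 3 N^2, and 36 = 12 * 3.\<close>

lemma
  fixes q a :: int
  assumes q: "0 < q" and a: "\<bar>a\<bar> \<le> q" and N: "1 \<le> N"
  defines "t \<equiv> real_of_int a / real_of_int q"
  shows half_sum_fst: "\<bar>fst (half_sum N q a) + 2 * t / 3 * height N\<bar> \<le> 36 * real N powr (23/8)"
    and half_sum_snd: "\<bar>snd (half_sum N q a) - (1 - t\<^sup>2 / 3) * height N\<bar> \<le> 36 * real N powr (23/8)"
proof -
  have sq: "3 * (real N)\<^sup>2 \<le> 3 * real N powr (23/8)" if "1 \<le> N" for N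
    using square_le_powr[OF that] by simp
  have "\<bar>fst (half_sum N q a) + 2 * t / 3 * height N\<bar> \<le> 12 * 3 * real N powr (23/8)"
  proof (rule dilation_sum_bound[OF _ N])
    fix N :: nat assume N: "1 \<le> N"
    have "(\<Sum>d=1..N. real d * (fst (half_sum (N div d) q a) + 2 * t / 3 * height (N div d)))
      = (\<Sum>d=1..N. real d * fst (half_sum (N div d) q a))
        + 2 * t / 3 * (\<Sum>d=1..N. real d * height (N div d))"
      by (simp add: sum_distrib_left sum.distrib algebra_simps)
    then show "\<bar>\<Sum>d=1..N. real d * (fst (half_sum (N div d) q a) + 2 * t / 3 * height (N div d))\<bar>
      \<le> 3 * real N powr (23/8)"
      using half_box_sum_fst[OF q a, of N] sq[OF N]
      unfolding sum_dilated_height sum_dilated_fst_half_sum t_def by linarith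
  qed
  then show "\<bar>fst (half_sum N q a) + 2 * t / 3 * height N\<bar> \<le> 36 * real N powr (23/8)" by simp
  have "\<bar>snd (half_sum N q a) - (1 - t\<^sup>2 / 3) * height N\<bar> \<le> 12 * 3 * real N powr (23/8)"
  proof (rule dilation_sum_bound[OF _ N])
    fix N :: nat assume N: "1 \<le> N"
    have "(\<Sum>d=1..N. real d * (snd (half_sum (N div d) q a) - (1 - t\<^sup>2 / 3) * height (N div d)))
      = (\<Sum>d=1..N. real d * snd (half_sum (N div d) q a))
        - (1 - t\<^sup>2 / 3) * (\<Sum>d=1..N. real d * height (N div d))"
      by (simp add: sum_distrib_left sum_subtractf sum.distrib algebra_simps)
    then show "\<bar>\<Sum>d=1..N. real d * (snd (half_sum (N div d) q a) - (1 - t\<^sup>2 / 3) * height (N div d))\<bar>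
      \<le> 3 * real N powr (23/8)"
      using half_box_sum_snd[OF q a, of N] sq[OF N]
      unfolding sum_dilated_height sum_dilated_snd_half_sum t_def by linarith
  qed
  then show "\<bar>snd (half_sum N q a) - (1 - t\<^sup>2 / 3) * height N\<bar> \<le> 36 * real N powr (23/8)" by simp
qed

lemma height_nonneg: "0 \<le> height N"
  unfolding height_def half_sum_def snd_sum
  by (rule sum_nonneg) (auto simp: half_plane_def real_vec_def)

text \<open>The term d = 1 of \<open>sum_dilated_height\<close> is isolated. Since
  \<open>height M \<le> lattice_sum M\<close>, the terms with \<open>d \<ge> 2\<close> amount to at
  most 11/12 of N^3 plus lower order, while \<open>lattice_sum N\<close> is at least N^3; a cubic
  term N^3 / 12 remains.\<close>

lemma height_lower_bound: "real N ^ 3 / 12 - 2 * real N powr (23/8) \<le> height N"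
proof (cases "N = 0")
  case False
  then have N: "1 \<le> N" by simp
  have split: "lattice_sum M = height M + (\<Sum>d=2..M. real d * height (M div d))" if "1 \<le> M" for M
    unfolding sum_dilated_height[symmetric]
    using that by (subst sum.atLeast_Suc_atMost) (auto simp: numeral_2_eq_2)
  have upper: "height M \<le> real M ^ 3 + 2 * real M powr (23/8)" if M: "1 \<le> M" for M
  proof -
    have "height M \<le> lattice_sum M"
      unfolding split[OF M] using height_nonneg by (simp add: sum_nonneg)
    also have "\<dots> = real M ^ 3 + 3/2 * (real M)\<^sup>2 + 1/2 * real M"
      by (simp add: lattice_sum_def power2_eq_square power3_eq_cube field_simps)
    also have "\<dots> \<le> real M ^ 3 + 2 * (real M)\<^sup>2"
    proof -
      have "real M * 1 \<le> real M * real M" using M by (intro mult_left_mono) auto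
      then show ?thesis unfolding power2_eq_square by linarith
    qed
    finally show ?thesis using square_le_powr[OF M] by linarith
  qed
  define B where "B = real N ^ 3 + 2 * real N powr (23/8)"
  have "(\<Sum>d=2..N. real d * height (N div d)) \<le> (\<Sum>d=2..N. B * real d powr (- 15/8))"
  proof (rule sum_mono)
    fix d assume d: "d \<in> {2..N}"
    have "real d * real (N div d) ^ 3 \<le> real d * (real N / real d) ^ 3"
      by (intro mult_left_mono power_mono of_nat_div_le_of_nat) auto
    also have "\<dots> = real N ^ 3 * real d powr - 2"
      using d by (simp add: power3_eq_cube field_simps powr_minus powr_numeral power2_eq_square)
    \<comment> \<open>Weakening the exponent -2 to -15/8 lets the single bound 11/12 serve the main
      term and the error term together.\<close>
    also have "\<dots> \<le> real N ^ 3 * real d powr (- 15/8)"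
      using d by (intro mult_left_mono powr_mono) auto
    finally have "real d * real (N div d) ^ 3 \<le> real N ^ 3 * real d powr (- 15/8)" .
    moreover have "real d * real (N div d) powr (23/8) \<le> real N powr (23/8) * real d powr (- 15/8)"
      using d by (intro mult_div_powr_le) auto
    moreover have "real d * height (N div d) \<le> real d * (real (N div d) ^ 3 + 2 * real (N div d) powr (23/8))"
      using d by (intro mult_left_mono upper) (auto simp: Suc_le_eq div_greater_zero_iff)
    ultimately show "real d * height (N div d) \<le> B * real d powr (- 15/8)"
      by (simp add: B_def algebra_simps)
  qed
  also have "\<dots> = B * (\<Sum>d=2..N. real d powr (- 15/8))" by (simp add: sum_distrib_left)
  also have "\<dots> \<le> B * (11/12)" by (intro mult_left_mono sum_powr_from_2_le) (simp add: B_def)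
  finally have "(\<Sum>d=2..N. real d * height (N div d)) \<le> B * (11/12)" .
  moreover have "real N ^ 3 \<le> lattice_sum N"
    by (simp add: lattice_sum_def power2_eq_square power3_eq_cube field_simps)
  moreover have "X / 12 - 2 * Y \<le> h" if "S \<le> (X + 2 * Y) * (11/12)" "X \<le> T" "T = h + S" "0 \<le> Y"
    for S T X Y h :: real
    using that by (simp add: field_simps)
  ultimately show ?thesis
    using split[OF N] powr_ge_zero[of "real N" "23/8"] unfolding B_def by blast
qed (simp add: height_nonneg)

section \<open>Edge midpoints of a centrally symmetric convex polygon\<close>

text \<open>Indices are read modulo the length, so that a walk around the polygon can start at any
  vertex and run past the end of the list.\<close>

definition vertex :: "(real \<times> real) list \<Rightarrow> nat \<Rightarrow> real \<times> real" where
  "vertex vs k = vs ! (k mod length vs)"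

definition edge :: "(real \<times> real) list \<Rightarrow> nat \<Rightarrow> real \<times> real" where
  "edge vs k = vertex vs (Suc k) - vertex vs k"

lemma edge_eq_edge_vector:
  assumes "vs \<noteq> []"
  shows "edge vs k = edge_vector vs (k mod length vs)"
  using assms by (simp add: edge_def vertex_def edge_vector_def next_vertex_def mod_Suc_eq)

lemma polygon_curve_eq_vertex:
  assumes "vs \<noteq> []"
  shows "polygon_curve vs = (\<Union>k. closed_segment (vertex vs k) (vertex vs (Suc k)))"
proof (intro equalityI subsetI)
  fix x assume "x \<in> (\<Union>k. closed_segment (vertex vs k) (vertex vs (Suc k)))"
  then obtain k where "x \<in> closed_segment (vertex vs k) (vertex vs (Suc k))" by blast
  then have "x \<in> closed_segment (vs ! (k mod length vs)) (next_vertex vs (k mod length vs))"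
    by (simp add: vertex_def next_vertex_def mod_Suc_eq)
  moreover have "k mod length vs < length vs" using assms by simp
  ultimately show "x \<in> polygon_curve vs" unfolding polygon_curve_def by blast
next
  fix x assume "x \<in> polygon_curve vs"
  then obtain i where "i < length vs" "x \<in> closed_segment (vs ! i) (next_vertex vs i)"
    unfolding polygon_curve_def by blast
  then have "x \<in> closed_segment (vertex vs i) (vertex vs (Suc i))"
    by (simp add: vertex_def next_vertex_def)
  then show "x \<in> (\<Union>k. closed_segment (vertex vs k) (vertex vs (Suc k)))" by blast
qed

section \<open>Convexity and the angular order of the edges\<close>

lemma cross2_diff_vertex_pos:
  assumes conv: "convex_polygon_ccw vs"
    and j: "j mod length vs \<noteq> i mod length vs" "j mod length vs \<noteq> Suc i mod length vs"
  shows "0 < cross2 (edge vs i) (vertex vs j - vertex vs i)"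
proof -
  have n: "3 \<le> length vs" using conv by (simp add: convex_polygon_ccw_def)
  then have "vs \<noteq> []" by auto
  moreover from this have "i mod length vs < length vs" "j mod length vs < length vs" by simp_all
  ultimately show ?thesis
    using conv j by (simp add: convex_polygon_ccw_def edge_eq_edge_vector vertex_def mod_Suc_eq)
qed

lemma cross2_diff_vertex_nonneg:
  assumes "convex_polygon_ccw vs"
  shows "0 \<le> cross2 (edge vs i) (vertex vs j - vertex vs i)"
proof (cases "j mod length vs = i mod length vs \<or> j mod length vs = Suc i mod length vs")
  case True
  then have "vertex vs j - vertex vs i = 0 \<or> vertex vs j - vertex vs i = edge vs i"
    by (auto simp: vertex_def edge_def)
  then have "cross2 (edge vs i) (vertex vs j - vertex vs i) = 0"
    by (metis cross2_simps(5) cross2_simps(7))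
  then show ?thesis by simp
next
  case False
  then show ?thesis using cross2_diff_vertex_pos[OF assms, of j i] by simp
qed

lemma Suc_Suc_mod_neq:
  fixes n :: nat
  assumes "3 \<le> n"
  shows "Suc (Suc i) mod n \<noteq> i mod n" "Suc (Suc i) mod n \<noteq> Suc i mod n"
proof -
  show "Suc (Suc i) mod n \<noteq> i mod n"
  proof
    assume "Suc (Suc i) mod n = i mod n"
    then have "n dvd Suc (Suc i) - i" by (rule mod_eq_dvd_iff_nat[THEN iffD1, rotated]) simp
    then show False using assms by (auto dest: dvd_imp_le)
  qed
  show "Suc (Suc i) mod n \<noteq> Suc i mod n"
  proof
    assume "Suc (Suc i) mod n = Suc i mod n"
    then have "n dvd Suc (Suc i) - Suc i" by (rule mod_eq_dvd_iff_nat[THEN iffD1, rotated]) simp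
    then show False using assms by (auto dest: dvd_imp_le)
  qed
qed

text \<open>The polygon lies in the cone spanned at a vertex by the two adjacent edges.\<close>

lemma local_min_vertex_is_global_min:
  assumes conv: "convex_polygon_ccw vs"
    and j: "cross2 u (edge vs j) \<le> 0" "0 \<le> cross2 u (edge vs (Suc j))"
  shows "cross2 u (vertex vs (Suc j)) \<le> cross2 u (vertex vs k)"
proof -
  have n: "3 \<le> length vs" using conv by (simp add: convex_polygon_ccw_def)
  define w where "w = vertex vs k - vertex vs (Suc j)"
  define e f where "e = edge vs j" and "f = edge vs (Suc j)"
  have "w = (vertex vs k - vertex vs j) - e" by (simp add: w_def e_def edge_def)
  then have "cross2 e w = cross2 e (vertex vs k - vertex vs j)" by (simp only: cross2_simps(1-7) diff_zero)
  then have ew: "0 \<le> cross2 e w" using cross2_diff_vertex_nonneg[OF conv, of j k] by (simp add: e_def)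
  have fw: "0 \<le> cross2 f w" using cross2_diff_vertex_nonneg[OF conv, of "Suc j" k] by (simp add: f_def w_def)
  have "vertex vs (Suc (Suc j)) - vertex vs j = e + f" by (simp add: e_def f_def edge_def)
  then have "cross2 e (vertex vs (Suc (Suc j)) - vertex vs j) = cross2 e f"
    by (simp only: cross2_simps(1-7) add_0)
  then have ef: "0 < cross2 e f"
    using cross2_diff_vertex_pos[OF conv, of "Suc (Suc j)" j] Suc_Suc_mod_neq[OF n] by (simp add: e_def)
  \<comment> \<open>Cramer's rule in the basis e, f: w has the coordinate
    \<open>cross2 e w / cross2 e f\<close> \<ge> 0 along f and
    \<open>- cross2 f w / cross2 e f\<close> \<le> 0 along e.\<close>
  have "cross2 e f * cross2 u w = cross2 e w * cross2 u f - cross2 f w * cross2 u e"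
    by (simp add: cross2_def algebra_simps)
  also have "0 \<le> cross2 e w * cross2 u f" using ew j by (simp add: f_def)
  then have "0 \<le> cross2 e w * cross2 u f - cross2 f w * cross2 u e"
    using mult_nonneg_nonpos[OF fw j(1)[folded e_def]] by linarith
  finally have "0 \<le> cross2 u w" using ef by (simp add: zero_le_mult_iff)
  then show ?thesis by (simp add: w_def cross2_simps(1-7))
qed

lemma cross2_edge_neg_after_nonpos:
  assumes conv: "convex_polygon_ccw vs"
    and l: "1 \<le> l" "cross2 (edge vs i) (edge vs (i + l)) \<le> 0" and l': "l + Suc k < length vs"
  shows "cross2 (edge vs i) (edge vs (i + (l + Suc k))) < 0"
  using l'
proof (induction k)
  have step: "cross2 (edge vs i) (edge vs (i + Suc l)) < 0"
    if l: "1 \<le> l" "cross2 (edge vs i) (edge vs (i + l)) \<le> 0" "Suc l < length vs" for l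
  proof (rule ccontr)
    let ?n = "length vs"
    assume "\<not> cross2 (edge vs i) (edge vs (i + Suc l)) < 0"
    then have "cross2 (edge vs i) (vertex vs (Suc (i + l))) \<le> cross2 (edge vs i) (vertex vs i)"
      using local_min_vertex_is_global_min[OF conv, of "edge vs i" "i + l" i] l by simp
    moreover have "Suc (i + l) mod ?n \<noteq> i mod ?n"
    proof
      assume "Suc (i + l) mod ?n = i mod ?n"
      then have "?n dvd Suc (i + l) - i" by (rule mod_eq_dvd_iff_nat[THEN iffD1, rotated]) simp
      then show False using l by (auto dest: dvd_imp_le)
    qed
    moreover have "Suc (i + l) mod ?n \<noteq> Suc i mod ?n"
    proof
      assume "Suc (i + l) mod ?n = Suc i mod ?n"
      then have "?n dvd Suc (i + l) - Suc i" by (rule mod_eq_dvd_iff_nat[THEN iffD1, rotated]) simp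
      then show False using l by (auto dest: dvd_imp_le)
    qed
    ultimately show False
      using cross2_diff_vertex_pos[OF conv, of "Suc (i + l)" i] by (simp add: cross2_simps(1-7))
  qed
  {
    case 0
    then show ?case using step[of l] l by simp
  next
    case (Suc k)
    then show ?case using step[of "l + Suc k"] l by simp
  }
qed

lemma sum_edges: "(\<Sum>k<m. edge vs (i + k)) = vertex vs (i + m) - vertex vs i"
  by (induction m) (simp_all add: edge_def)

lemma bij_betw_add_mod:
  fixes n :: nat
  shows "bij_betw (\<lambda>l. (i + l) mod n) {..<n} {..<n}"
proof (cases "n = 0")
  case False
  have "inj_on (\<lambda>l. (i + l) mod n) {..<n}"
  proof (rule linorder_inj_onI)
    fix l l' assume l: "l < l'" "l \<in> {..<n}" "l' \<in> {..<n}"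
    show "(i + l) mod n \<noteq> (i + l') mod n"
    proof
      assume "(i + l) mod n = (i + l') mod n"
      then have "n dvd (i + l') - (i + l)"
        using l by (intro mod_eq_dvd_iff_nat[THEN iffD1]) auto
      then show False using l by (auto dest: dvd_imp_le)
    qed
  qed auto
  moreover from this have "(\<lambda>l. (i + l) mod n) ` {..<n} = {..<n}"
    using False by (intro endo_inj_surj) auto
  ultimately show ?thesis by (simp add: bij_betw_def)
qed simp

text \<open>By symmetry of V the vector - u of the opposite edge occurs at some offset \<mu>. Edges
  after it have negative cross product with u. Edges before it have a positive one, since a
  nonpositive value there would force a strictly negative one at \<mu>, where it is 0. So the
  vectors to the left of u are consecutive edges, and their sum telescopes.\<close>

lemma opposite_edge:
  assumes conv: "convex_polygon_ccw vs"
    and bij: "bij_betw (edge_vector vs) {..<length vs} V"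
    and sym: "\<And>w. w \<in> V \<Longrightarrow> - w \<in> V"
  obtains m where "edge vs (Suc i + m) = - edge vs i"
    "vertex vs (Suc i + m) - vertex vs (Suc i) = (\<Sum>w | w \<in> V \<and> 0 < cross2 (edge vs i) w. w)"
proof -
  let ?n = "length vs" and ?u = "edge vs i"
  have n: "3 \<le> ?n" using conv by (simp add: convex_polygon_ccw_def)
  then have ne: "vs \<noteq> []" by auto
  have "(\<lambda>l. edge vs (i + l)) = edge_vector vs \<circ> (\<lambda>l. (i + l) mod ?n)"
    using edge_eq_edge_vector[OF ne] by (simp add: fun_eq_iff)
  then have bij: "bij_betw (\<lambda>l. edge vs (i + l)) {..<?n} V"
    using bij_betw_trans[OF bij_betw_add_mod[of i ?n] bij] by simp
  have "edge vs (i + 0) \<in> V" using n by (intro bij_betwE[OF bij, rule_format]) auto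
  then have "- ?u \<in> V" using sym by simp
  then have "- ?u \<in> (\<lambda>l. edge vs (i + l)) ` {..<?n}"
    using bij_betw_imp_surj_on[OF bij] by simp
  then obtain \<mu> where \<mu>: "\<mu> < ?n" "edge vs (i + \<mu>) = - ?u" by auto
  have "0 < cross2 ?u (vertex vs (Suc (Suc i)) - vertex vs i)"
    using cross2_diff_vertex_pos[OF conv, of "Suc (Suc i)" i] Suc_Suc_mod_neq[OF n] by simp
  then have "?u \<noteq> 0" by (auto simp: cross2_simps(1-7))
  have "\<mu> \<noteq> 0"
  proof
    assume "\<mu> = 0"
    then have "fst ?u = - fst ?u" "snd ?u = - snd ?u" using \<mu>(2) by (auto simp: prod_eq_iff)
    then show False using \<open>?u \<noteq> 0\<close> by (simp add: prod_eq_iff)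
  qed
  \<comment> \<open>The edges strictly between offsets 0 and \<mu> number \<mu> - 1 and lead from
    vertex \<open>Suc i\<close> to vertex \<open>i + \<mu>\<close>, which is
    \<open>Suc i + m\<close>.\<close>
  then obtain m where m: "\<mu> = Suc m" by (cases \<mu>) auto
  have zero: "cross2 ?u (edge vs (i + \<mu>)) = 0" by (simp add: \<mu> cross2_simps(1-7))
  have neg: "cross2 ?u (edge vs (i + l)) < 0" if "\<mu> < l" "l < ?n" for l
  proof -
    define k where "k = l - Suc \<mu>"
    have "l = \<mu> + Suc k" using that by (simp add: k_def)
    then show ?thesis
      using cross2_edge_neg_after_nonpos[OF conv, of \<mu> i k] that zero \<open>\<mu> \<noteq> 0\<close> by simp
  qed
  have pos: "0 < cross2 ?u (edge vs (i + l))" if "1 \<le> l" "l < \<mu>" for l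
    using cross2_edge_neg_after_nonpos[OF conv, of l i "\<mu> - Suc l"] that zero \<mu>(1)
    by force
  have "{l \<in> {..<?n}. 0 < cross2 ?u (edge vs (i + l))} = {1..<\<mu>}"
  proof (intro equalityI subsetI)
    fix l assume l: "l \<in> {l \<in> {..<?n}. 0 < cross2 ?u (edge vs (i + l))}"
    have "l \<noteq> 0"
    proof
      assume "l = 0"
      then show False using l by (simp add: cross2_simps(5))
    qed
    moreover have "l \<noteq> \<mu>" using l zero by auto
    moreover have "\<not> \<mu> < l" using l neg[of l] by auto
    ultimately show "l \<in> {1..<\<mu>}" by auto
  qed (use pos \<mu>(1) in auto)
  then have img: "{w. w \<in> V \<and> 0 < cross2 ?u w} = (\<lambda>l. edge vs (i + l)) ` {1..<\<mu>}"
    using bij_betw_imp_surj_on[OF bij] by blast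
  have "inj_on (\<lambda>l. edge vs (i + l)) {1..<\<mu>}"
    using bij \<mu>(1) by (auto simp: bij_betw_def intro: inj_on_subset)
  then have "(\<Sum>w | w \<in> V \<and> 0 < cross2 ?u w. w) = (\<Sum>l=1..<\<mu>. edge vs (i + l))"
    unfolding img by (simp add: sum.reindex)
  also have "\<dots> = (\<Sum>l<m. edge vs (Suc i + l))"
    using sum.shift_bounds_Suc_ivl[of "\<lambda>l. edge vs (i + l)" 0 m] by (simp add: m lessThan_atLeast0)
  finally show thesis
    using that[of m] \<mu>(2) sum_edges[of vs "Suc i" m] by (simp add: m)
qed

section \<open>Supporting lines and central symmetry\<close>

text \<open>The functional \<open>cross2 (edge vs i)\<close> is affine on every edge, so its minimum
  over the curve is found at vertices, and convexity leaves only the two ends of edge i.\<close>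

lemma
  assumes conv: "convex_polygon_ccw vs"
  shows cross2_edge_polygon_curve:
    "x \<in> polygon_curve vs \<Longrightarrow> cross2 (edge vs i) (vertex vs i) \<le> cross2 (edge vs i) x"
    and polygon_curve_supporting_line:
    "{x \<in> polygon_curve vs. cross2 (edge vs i) x = cross2 (edge vs i) (vertex vs i)}
      = closed_segment (vertex vs i) (vertex vs (Suc i))" (is "?A = ?B")
proof -
  let ?n = "length vs" and ?L = "cross2 (edge vs i)"
  have ne: "vs \<noteq> []" using conv by (auto simp: convex_polygon_ccw_def)
  note curve = polygon_curve_eq_vertex[OF ne]
  have L: "?L ((1 - t) *\<^sub>R a + t *\<^sub>R b) = (1 - t) * ?L a + t * ?L b" for t a b
    by (simp add: cross2_def algebra_simps)
  have vert: "?L (vertex vs i) \<le> ?L (vertex vs k)" for k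
    using cross2_diff_vertex_nonneg[OF conv, of i k] by (simp add: cross2_simps(1-7))
  have strict: "vertex vs k = vertex vs i \<or> vertex vs k = vertex vs (Suc i)"
    if "?L (vertex vs k) = ?L (vertex vs i)" for k
  proof -
    have "cross2 (edge vs i) (vertex vs k - vertex vs i) = 0" using that by (simp add: cross2_simps(4))
    then have "k mod ?n = i mod ?n \<or> k mod ?n = Suc i mod ?n"
      using cross2_diff_vertex_pos[OF conv, of k i] by auto
    then show ?thesis by (auto simp: vertex_def)
  qed
  show le: "?L (vertex vs i) \<le> ?L x" if "x \<in> polygon_curve vs" for x
  proof -
    from that obtain k t where t: "0 \<le> t" "t \<le> 1"
      and x: "x = (1 - t) *\<^sub>R vertex vs k + t *\<^sub>R vertex vs (Suc k)"
      unfolding curve by (auto simp: closed_segment_def)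
    have "?L x - ?L (vertex vs i) = (1 - t) * (?L (vertex vs k) - ?L (vertex vs i))
        + t * (?L (vertex vs (Suc k)) - ?L (vertex vs i))"
      unfolding x L by (simp add: algebra_simps)
    also have "0 \<le> \<dots>" using t vert by simp
    finally show ?thesis by simp
  qed
  show "?A = ?B"
  proof (intro equalityI subsetI)
    fix x assume x: "x \<in> ?A"
    then obtain k t where t: "0 \<le> t" "t \<le> 1"
      and xt: "x = (1 - t) *\<^sub>R vertex vs k + t *\<^sub>R vertex vs (Suc k)"
      unfolding curve by (auto simp: closed_segment_def)
    have "?L x - ?L (vertex vs i) = (1 - t) * (?L (vertex vs k) - ?L (vertex vs i))
        + t * (?L (vertex vs (Suc k)) - ?L (vertex vs i))"
      unfolding xt L by (simp add: algebra_simps)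
    \<comment> \<open>A sum of two nonnegative terms vanishes, so each end of the segment either has
      weight 0 or lies at the minimal level.\<close>
    then have "(1 - t) * (?L (vertex vs k) - ?L (vertex vs i)) = 0
        \<and> t * (?L (vertex vs (Suc k)) - ?L (vertex vs i)) = 0"
      using x t vert
      by (subst add_nonneg_eq_0_iff[symmetric]) (auto intro!: mult_nonneg_nonneg simp: diff_ge_0_iff_ge)
    then have "t = 1 \<or> vertex vs k \<in> ?B" "t = 0 \<or> vertex vs (Suc k) \<in> ?B"
      using strict[of k] strict[of "Suc k"] by auto
    then consider "t = 1" "vertex vs (Suc k) \<in> ?B" | "t = 0" "vertex vs k \<in> ?B"
      | "vertex vs k \<in> ?B" "vertex vs (Suc k) \<in> ?B" by fastforce
    then show "x \<in> ?B"
    proof cases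
      case 3
      then have "closed_segment (vertex vs k) (vertex vs (Suc k)) \<subseteq> ?B"
        by (simp add: subset_closed_segment)
      then show ?thesis using t xt by (auto simp: closed_segment_def)
    qed (use xt in auto)
  next
    fix x assume x: "x \<in> ?B"
    then obtain t where xt: "x = (1 - t) *\<^sub>R vertex vs i + t *\<^sub>R vertex vs (Suc i)"
      by (auto simp: closed_segment_def)
    have "?L (vertex vs (Suc i)) = ?L (vertex vs i)"
      using cross2_simps(5)[of "edge vs i"] by (simp add: edge_def cross2_simps(4))
    then have "?L x = ?L (vertex vs i)" unfolding xt L by (simp add: algebra_simps)
    then show "x \<in> ?A" using x unfolding curve by blast
  qed
qed

text \<open>The reflection in c exchanges the supporting lines at the lowest and the highest level
  of \<open>?L\<close>, hence edge i and its opposite edge. The sum of the left-hand edges joins one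
  to the other and so determines the midpoint relative to c.\<close>

lemma edge_midpoint:
  assumes conv: "convex_polygon_ccw vs"
    and bij: "bij_betw (edge_vector vs) {..<length vs} V"
    and sym: "\<And>w. w \<in> V \<Longrightarrow> - w \<in> V"
    and c: "symmetry_center (polygon_curve vs) c"
  shows "midpoint (vertex vs i) (vertex vs (Suc i)) - c
    = - (1/2) *\<^sub>R (\<Sum>w | w \<in> V \<and> 0 < cross2 (edge vs i) w. w)" (is "_ = - (1/2) *\<^sub>R ?S")
proof -
  let ?C = "polygon_curve vs" and ?L = "cross2 (edge vs i)" and ?R = "\<lambda>x. 2 *\<^sub>R c - x"
  obtain m where "edge vs (Suc i + m) = - edge vs i" "vertex vs (Suc i + m) - vertex vs (Suc i) = ?S"
    by (rule opposite_edge[OF conv bij sym])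
  then obtain k where k: "edge vs k = - edge vs i" "vertex vs k - vertex vs (Suc i) = ?S"
    by blast
  have ne: "vs \<noteq> []" using conv by (auto simp: convex_polygon_ccw_def)
  have vert: "vertex vs j \<in> ?C" for j unfolding polygon_curve_eq_vertex[OF ne] by auto
  have RC: "?R ` ?C = ?C" using c by (simp add: symmetry_center_def)
  have LR: "?L (?R x) = 2 * ?L c - ?L x" for x by (simp add: cross2_def algebra_simps)
  have lower: "?L (vertex vs i) \<le> ?L x" if "x \<in> ?C" for x
    using cross2_edge_polygon_curve[OF conv that] .
  have upper: "?L x \<le> ?L (vertex vs k)" if "x \<in> ?C" for x
    using cross2_edge_polygon_curve[OF conv that, of k] by (simp add: k cross2_simps(1-7))
  \<comment> \<open>The reflected minimum is at most the maximum and the reflected maximum at least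
    the minimum, so the two extreme levels are symmetric about the level of c.\<close>
  have "?R (vertex vs i) \<in> ?C" "?R (vertex vs k) \<in> ?C" using RC vert by blast+
  from upper[OF this(1)] lower[OF this(2)]
  have LL: "?L (vertex vs i) + ?L (vertex vs k) = 2 * ?L c" unfolding LR by simp
  have "closed_segment (?R (vertex vs i)) (?R (vertex vs (Suc i)))
    = ?R ` closed_segment (vertex vs i) (vertex vs (Suc i))"
  proof -
    have "closed_segment (?R a) (?R b) = ?R ` closed_segment a b" for a b
    proof -
      have "(1 - t) *\<^sub>R ?R a + t *\<^sub>R ?R b = ?R ((1 - t) *\<^sub>R a + t *\<^sub>R b)" for t
        by (simp add: prod_eq_iff algebra_simps)
      then show ?thesis unfolding closed_segment_def by fastforce
    qed
    then show ?thesis .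
  qed
  also have "\<dots> = ?R ` {x \<in> ?C. ?L x = ?L (vertex vs i)}"
    by (simp only: polygon_curve_supporting_line[OF conv])
  also have "\<dots> = {x \<in> ?R ` ?C. ?L x = ?L (vertex vs k)}"
  proof -
    have "?L (?R x) = ?L (vertex vs k) \<longleftrightarrow> ?L x = ?L (vertex vs i)" for x
      unfolding LR using LL by auto
    then show ?thesis by blast
  qed
  also have "\<dots> = closed_segment (vertex vs k) (vertex vs (Suc k))"
    using polygon_curve_supporting_line[OF conv, of k] unfolding RC by (simp add: k cross2_simps(1-7))
  finally have "{?R (vertex vs i), ?R (vertex vs (Suc i))} = {vertex vs k, vertex vs (Suc k)}"
    by (simp only: closed_segment_eq)
  \<comment> \<open>A segment fixes its ends only as an unordered pair, which suffices for their
    sum.\<close>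
  then have "?R (vertex vs i) + ?R (vertex vs (Suc i)) = vertex vs k + vertex vs (Suc k)"
    by (auto simp: doubleton_eq_iff)
  moreover have "vertex vs k = ?S + vertex vs (Suc i)" using k(2) by (simp add: algebra_simps)
  moreover have "vertex vs (Suc k) = vertex vs k + (vertex vs i - vertex vs (Suc i))"
    using k(1) by (simp add: edge_def algebra_simps)
  ultimately have "4 *\<^sub>R c = 2 *\<^sub>R ?S + 2 *\<^sub>R (vertex vs i + vertex vs (Suc i))"
    by (simp add: prod_eq_iff algebra_simps)
  then show ?thesis by (simp add: midpoint_def prod_eq_iff field_simps)
qed

section \<open>Convergence\<close>

lemma norm_real_pair_le: "norm (x :: real \<times> real) \<le> \<bar>fst x\<bar> + \<bar>snd x\<bar>"
  using norm_Pair_le[of "fst x" "snd x"] by simp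

section \<open>Quarter turns\<close>

lemma norm_rot90_funpow: "norm ((rot90 ^^ k) x) = norm x"
  by (induction k) (simp_all add: rot90_def norm_prod_def add.commute)

lemma linear_rot90_funpow: "linear (rot90 ^^ k)"
proof (induction k)
  case (Suc k)
  have "linear rot90" by (rule linearI) (simp_all add: rot90_def)
  then show ?case using linear_compose[OF Suc] by (simp only: funpow.simps)
qed (simp add: linear_id flip: id_def)

text \<open>A quarter turn permutes \<open>jarnik_vectors Q\<close> and carries the half-plane of
  (q, a) to that of (- a, q).\<close>

lemma half_sum_rot90: "half_sum Q (- a) q = rot90 (half_sum Q q a)"
proof -
  have "half_sum Q (- a) q = (\<Sum>w | w \<in> jarnik_vectors Q \<and> half_plane q a w. rot90 (real_vec w))"
    unfolding half_sum_def
    by (rule sum.reindex_bij_witness[of _ "\<lambda>(x, y). (- y, x)" "\<lambda>(x, y). (y, - x)"])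
      (auto simp: half_plane_def jarnik_vectors_def real_vec_def rot90_def coprime_commute algebra_simps)
  also have "\<dots> = rot90 (half_sum Q q a)"
    by (simp add: half_sum_def rot90_def prod_eq_iff fst_sum snd_sum sum_negf)
  finally show ?thesis .
qed

text \<open>Reduction to slopes of modulus at most 1, where the half-box estimates apply: the
  quarter turns of the sector 0 < q, \<open>\<bar>a\<bar> \<le> q\<close> cover the plane without
  the origin.\<close>

lemma eq_rot90_right_sector:
  fixes q a :: int
  assumes "(q, a) \<noteq> (0, 0)"
  obtains k q' a' where "k < 4" "0 < q'" "\<bar>a'\<bar> \<le> q'" "\<And>Q. half_sum Q q a = (rot90 ^^ k) (half_sum Q q' a')"
proof -
  note rot = half_sum_rot90
  have "0 < q \<and> \<bar>a\<bar> \<le> q \<or> 0 < a \<and> \<bar>q\<bar> \<le> a \<or> q < 0 \<and> \<bar>a\<bar> \<le> - q \<or> a < 0 \<and> \<bar>q\<bar> \<le> - a"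
    using assms by (simp, arith)
  then consider "0 < q" "\<bar>a\<bar> \<le> q" | "0 < a" "\<bar>q\<bar> \<le> a" | "q < 0" "\<bar>a\<bar> \<le> - q" | "a < 0" "\<bar>q\<bar> \<le> - a"
    by blast
  then show thesis
  proof cases
    case 1
    then show ?thesis using that[of 0 q a] by simp
  next
    case 2
    have "half_sum Q q a = (rot90 ^^ 1) (half_sum Q a (- q))" for Q
      using rot[of Q "- q" a] by simp
    then show ?thesis using that[of 1 a "- q"] 2 by simp
  next
    case 3
    have "half_sum Q q a = (rot90 ^^ 2) (half_sum Q (- q) (- a))" for Q
      using rot[of Q "- q" a] rot[of Q "- a" "- q"] by (simp add: numeral_2_eq_2)
    then show ?thesis using that[of 2 "- q" "- a"] 3 by simp
  next
    case 4
    have "half_sum Q q a = (rot90 ^^ 3) (half_sum Q (- a) q)" for Q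
      using rot[of Q "- q" a] rot[of Q "- a" "- q"] rot[of Q q "- a"] by (simp add: numeral_3_eq_3)
    then show ?thesis using that[of 3 "- a" q] 4 by simp
  qed
qed

section \<open>Distance to the limit curve\<close>

lemma infdist_half_sum_le:
  fixes q a :: int
  assumes N: "1 \<le> N" and qa: "(q, a) \<noteq> (0, 0)" and h: "0 < height N"
  shows "infdist (- (1 / height N) *\<^sub>R half_sum N q a) limit_curve \<le> 72 * real N powr (23/8) / height N"
proof -
  obtain k q' a' where k: "k < 4" and q': "0 < q'" "\<bar>a'\<bar> \<le> q'"
    and rot: "half_sum N q a = (rot90 ^^ k) (half_sum N q' a')"
    using eq_rot90_right_sector[OF qa] by metis
  define t where "t = real_of_int a' / real_of_int q'"
  \<comment> \<open>The point of the arc with abscissa 2t/3, since 3/4 (2t/3)^2 = t^2/3; the range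
    \<open>\<bar>t\<bar> \<le> 1\<close> matches the ends -2/3 and 2/3 of the arc.\<close>
  define z where "z = (2 * t / 3, t\<^sup>2 / 3 - 1)"
  define p where "p = - (1 / height N) *\<^sub>R half_sum N q' a'"
  have t: "- 1 \<le> t" "t \<le> 1" using q' by (auto simp: t_def divide_le_eq le_divide_eq)
  then have "z \<in> parabolic_arc"
    by (auto simp: parabolic_arc_def z_def power2_eq_square intro!: exI[of _ "2 * t / 3"])
  then have "(rot90 ^^ k) z \<in> limit_curve" unfolding limit_curve_def using k by blast
  then have "infdist ((rot90 ^^ k) p) limit_curve \<le> dist ((rot90 ^^ k) p) ((rot90 ^^ k) z)"
    by (rule infdist_le)
  also have "\<dots> = norm (p - z)"
    by (simp add: dist_norm norm_rot90_funpow flip: linear_diff[OF linear_rot90_funpow])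
  also have "\<dots> \<le> \<bar>fst (p - z)\<bar> + \<bar>snd (p - z)\<bar>" by (rule norm_real_pair_le)
  also have "fst (p - z) = - (fst (half_sum N q' a') + 2 * t / 3 * height N) / height N"
    using h by (simp add: p_def z_def field_simps)
  also have "snd (p - z) = - (snd (half_sum N q' a') - (1 - t\<^sup>2 / 3) * height N) / height N"
    using h by (simp add: p_def z_def field_simps)
  also have "\<bar>- (fst (half_sum N q' a') + 2 * t / 3 * height N) / height N\<bar>
      + \<bar>- (snd (half_sum N q' a') - (1 - t\<^sup>2 / 3) * height N) / height N\<bar>
    = (\<bar>fst (half_sum N q' a') + 2 * t / 3 * height N\<bar>
      + \<bar>snd (half_sum N q' a') - (1 - t\<^sup>2 / 3) * height N\<bar>) / height N"
    using h by (simp only: abs_divide abs_minus_cancel add_divide_distrib abs_of_pos)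
  also have "\<dots> \<le> 72 * real N powr (23/8) / height N"
    using half_sum_fst[OF q' N] half_sum_snd[OF q' N] h
    by (intro divide_right_mono) (auto simp: t_def)
  finally have "infdist ((rot90 ^^ k) p) limit_curve \<le> 72 * real N powr (23/8) / height N" .
  moreover have "(rot90 ^^ k) p = - (1 / height N) *\<^sub>R half_sum N q a"
    by (simp only: p_def rot linear_scale[OF linear_rot90_funpow])
  ultimately show ?thesis by simp
qed

lemma sum_real_vec_half_plane:
  "(\<Sum>w | w \<in> real_vec ` jarnik_vectors Q \<and> 0 < cross2 (real_vec (q, a)) w. w) = half_sum Q q a"
proof -
  have "real_of_int q * of_int y - of_int a * of_int x = of_int (q * y - a * x)" for x y by simp
  then have "0 < cross2 (real_vec (q, a)) (real_vec w) \<longleftrightarrow> half_plane q a w" for w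
    unfolding cross2_def real_vec_def half_plane_def fst_conv snd_conv by (simp only: of_int_0_less_iff)
  then have "{w. w \<in> real_vec ` jarnik_vectors Q \<and> 0 < cross2 (real_vec (q, a)) w}
    = real_vec ` {w. w \<in> jarnik_vectors Q \<and> half_plane q a w}" by auto
  moreover have "inj_on real_vec A" for A by (auto simp: inj_on_def real_vec_def prod_eq_iff)
  ultimately show ?thesis by (simp add: sum.reindex half_sum_def)
qed

lemma jarnik_polygon_edge_midpoint:
  assumes poly: "jarnik_polygon Q vs" and c: "symmetry_center (polygon_curve vs) c"
    and i: "i < length vs"
  obtains q a where "(q, a) \<in> jarnik_vectors Q" "edge_vector vs i = real_vec (q, a)"
    "midpoint (vs ! i) (next_vertex vs i) - c = - (1/2) *\<^sub>R half_sum Q q a"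
proof -
  let ?V = "real_vec ` jarnik_vectors Q"
  have conv: "convex_polygon_ccw vs" and bij: "bij_betw (edge_vector vs) {..<length vs} ?V"
    using poly by (auto simp: jarnik_polygon_def)
  have ne: "vs \<noteq> []" using i by auto
  have "- w \<in> ?V" if "w \<in> ?V" for w
  proof -
    from that obtain v where v: "v \<in> jarnik_vectors Q" "w = real_vec v" by blast
    then have "- v \<in> jarnik_vectors Q" by (cases v) (auto simp: jarnik_vectors_def)
    moreover have "- w = real_vec (- v)" using v by (simp add: real_vec_def prod_eq_iff)
    ultimately show ?thesis by blast
  qed
  note mid = edge_midpoint[OF conv bij this c, of i]
  obtain q a where qa: "(q, a) \<in> jarnik_vectors Q" "edge_vector vs i = real_vec (q, a)"
    using bij_betwE[OF bij] i by (metis imageE lessThan_iff surj_pair)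
  moreover have "midpoint (vs ! i) (next_vertex vs i) - c = - (1/2) *\<^sub>R half_sum Q q a"
    using mid i qa(2) sum_real_vec_half_plane[of Q q a]
    by (simp add: edge_eq_edge_vector[OF ne] vertex_def next_vertex_def)
  ultimately show thesis by (rule that)
qed

text \<open>A point of the polygon is at most half an edge away from an edge midpoint. Edges have
  length at most 2 Q before scaling by \<open>2 / height Q\<close>, which gives the second term; the
  first is the distance of the scaled midpoint from the curve.\<close>

lemma infdist_scaled_jarnik_polygon_le:
  assumes P: "scaled_jarnik_polygon Q P" and p: "p \<in> P" and h: "0 < height Q" and Q: "1 \<le> Q"
  shows "infdist p limit_curve \<le> (72 * real Q powr (23/8) + 2 * real Q) / height Q"
proof -
  obtain vs c r where poly: "jarnik_polygon Q vs" and c: "symmetry_center (polygon_curve vs) c"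
    and r: "0 < r" and P: "P = (\<lambda>x. r *\<^sub>R (x - c)) ` polygon_curve vs"
    and ex: "\<exists>i<length vs. edge_vector vs i = (1, 0) \<and>
           r *\<^sub>R (midpoint (vs ! i) (next_vertex vs i) - c) = (0, -1)"
    using P unfolding scaled_jarnik_polygon_def by blast
  \<comment> \<open>The normalisation fixes r: before scaling, the midpoint of the edge (1, 0) lies
    \<open>height Q / 2\<close> below the centre.\<close>
  have r_eq: "r = 2 / height Q"
  proof -
    from ex obtain i where i: "i < length vs" "edge_vector vs i = (1, 0)"
      and ri: "r *\<^sub>R (midpoint (vs ! i) (next_vertex vs i) - c) = (0, -1)" by blast
    obtain q a where "edge_vector vs i = real_vec (q, a)"
      "midpoint (vs ! i) (next_vertex vs i) - c = - (1/2) *\<^sub>R half_sum Q q a"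
      using jarnik_polygon_edge_midpoint[OF poly c i(1)] by metis
    moreover from this have "q = 1" "a = 0" using i(2) by (auto simp: real_vec_def)
    ultimately have "snd (r *\<^sub>R (- (1/2) *\<^sub>R half_sum Q 1 0)) = - 1" using ri by simp
    then have "r * height Q = 2" by (simp add: height_def)
    then show ?thesis using h by (simp add: field_simps)
  qed
  obtain x where x: "x \<in> polygon_curve vs" "p = r *\<^sub>R (x - c)" using p P by blast
  then obtain i where i: "i < length vs" "x \<in> closed_segment (vs ! i) (next_vertex vs i)"
    unfolding polygon_curve_def by blast
  let ?m = "midpoint (vs ! i) (next_vertex vs i)"
  obtain q a where qa: "(q, a) \<in> jarnik_vectors Q" "edge_vector vs i = real_vec (q, a)"
    "?m - c = - (1/2) *\<^sub>R half_sum Q q a"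
    by (rule jarnik_polygon_edge_midpoint[OF poly c i(1)])
  have rm: "r *\<^sub>R (?m - c) = - (1 / height Q) *\<^sub>R half_sum Q q a"
    unfolding qa(3) by (simp add: r_eq)
  have "(q, a) \<noteq> (0, 0)" using qa(1) by (auto simp: jarnik_vectors_def)
  then have "infdist (r *\<^sub>R (?m - c)) limit_curve \<le> 72 * real Q powr (23/8) / height Q"
    unfolding rm using infdist_half_sum_le[OF Q _ h] by blast
  moreover have "dist p (r *\<^sub>R (?m - c)) \<le> 2 * real Q / height Q"
  proof -
    obtain t where t: "0 \<le> t" "t \<le> 1" and xt: "x = (1 - t) *\<^sub>R vs ! i + t *\<^sub>R next_vertex vs i"
      using i(2) by (auto simp: closed_segment_def)
    have "x - ?m = (t - 1/2) *\<^sub>R edge_vector vs i"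
      by (simp add: xt midpoint_def edge_vector_def prod_eq_iff algebra_simps)
    then have "norm (x - ?m) = \<bar>t - 1/2\<bar> * norm (edge_vector vs i)" by simp
    also have "\<dots> \<le> 1/2 * (2 * real Q)"
    proof (rule mult_mono)
      have "\<bar>real_of_int q\<bar> \<le> real Q" "\<bar>real_of_int a\<bar> \<le> real Q"
        using qa(1) by (auto simp: jarnik_vectors_def simp flip: of_int_abs)
      then show "norm (edge_vector vs i) \<le> 2 * real Q"
        using norm_real_pair_le[of "edge_vector vs i"] by (simp add: qa(2) real_vec_def)
      have "- (1/2) \<le> t - 1/2" "t - 1/2 \<le> 1/2" using t by auto
      then show "\<bar>t - 1/2\<bar> \<le> 1/2" by (intro abs_leI) simp_all
    qed auto
    finally have "norm (x - ?m) \<le> real Q" by simp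
    moreover have "p - r *\<^sub>R (?m - c) = r *\<^sub>R (x - ?m)" by (simp add: x(2) algebra_simps)
    then have "dist p (r *\<^sub>R (?m - c)) = r * norm (x - ?m)" using r by (simp add: dist_norm)
    ultimately show ?thesis using r h mult_left_mono[of "norm (x - ?m)" "real Q" r] by (simp add: r_eq)
  qed
  ultimately show ?thesis
    using infdist_triangle[of p limit_curve "r *\<^sub>R (?m - c)"] by (simp add: add_divide_distrib)
qed

theorem theorem1:
  shows "\<forall>\<epsilon>>0. \<exists>Q\<^sub>0::nat. \<forall>Q>Q\<^sub>0. \<forall>P. scaled_jarnik_polygon Q P \<longrightarrow>
           (\<forall>p\<in>P. infdist p limit_curve < \<epsilon>)"
proof (intro allI impI)
  fix \<epsilon> :: real assume \<epsilon>: "0 < \<epsilon>"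
  define b where "b Q = real Q ^ 3 / 12 - 2 * real Q powr (23/8)" for Q :: nat
  have "((\<lambda>x::real. (72 * x powr (23/8) + 2 * x) / (x ^ 3 / 12 - 2 * x powr (23/8))) \<longlongrightarrow> 0) at_top"
    by real_asymp
  then have "((\<lambda>Q. (72 * real Q powr (23/8) + 2 * real Q) / b Q) \<longlongrightarrow> 0) sequentially"
    unfolding b_def by (rule filterlim_compose) (rule filterlim_real_sequentially)
  then have small: "\<forall>\<^sub>F Q in sequentially. (72 * real Q powr (23/8) + 2 * real Q) / b Q < \<epsilon>"
    using \<epsilon> by (rule order_tendstoD)
  \<comment> \<open>Positivity of b for large Q yields \<open>0 < height Q\<close> and allows
    \<open>height Q\<close> to be replaced by the smaller \<open>b Q\<close> in the
    denominator.\<close>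
  have "filterlim (\<lambda>x::real. x ^ 3 / 12 - 2 * x powr (23/8)) at_top at_top" by real_asymp
  then have "filterlim b at_top sequentially"
    unfolding b_def by (rule filterlim_compose) (rule filterlim_real_sequentially)
  then have "\<forall>\<^sub>F Q in sequentially. 0 < b Q" by (simp add: filterlim_at_top_dense)
  with small have "\<forall>\<^sub>F Q in sequentially. (72 * real Q powr (23/8) + 2 * real Q) / b Q < \<epsilon> \<and> 0 < b Q"
    by (rule eventually_conj)
  then obtain Q0 where Q0: "\<And>Q. Q0 \<le> Q \<Longrightarrow>
      (72 * real Q powr (23/8) + 2 * real Q) / b Q < \<epsilon> \<and> 0 < b Q"
    by (auto simp only: eventually_sequentially)
  have "infdist p limit_curve < \<epsilon>" if "Q0 < Q" "scaled_jarnik_polygon Q P" "p \<in> P" for Q P p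
  proof -
    have b: "0 < b Q" "b Q \<le> height Q" using Q0[of Q] that height_lower_bound[of Q] by (auto simp: b_def)
    have "infdist p limit_curve \<le> (72 * real Q powr (23/8) + 2 * real Q) / height Q"
      using infdist_scaled_jarnik_polygon_le that b by simp
    also have "\<dots> \<le> (72 * real Q powr (23/8) + 2 * real Q) / b Q"
      using b by (intro divide_left_mono) auto
    also have "\<dots> < \<epsilon>" using Q0[of Q] that by simp
    finally show ?thesis .
  qed
  then show "\<exists>Q\<^sub>0::nat. \<forall>Q>Q\<^sub>0. \<forall>P. scaled_jarnik_polygon Q P \<longrightarrow> (\<forall>p\<in>P. infdist p limit_curve < \<epsilon>)"
    by (intro exI[of _ Q0]) simp
qed

end
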